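(* Let $\mathcal{V}$ and $\mathcal{W}$ be closed symmetric monoidal categories and let $F \colon \mathcal{W} \rightleftarrows \mathcal{V} \colon G$ (with $F$ left adjoint) be an adjunction such that the right adjoint $G$ is lax monoidal; equip $F$ with the corresponding oplax monoidal structure. (1) If $F$ is strong monoidal, then for a $\mathcal{V}$-category $\mathcal{C}$ which is tensored (respectively, cotensored) over $\mathcal{V}$, the $\mathcal{W}$-category $G_*\mathcal{C}$ admits a tensoring (respectively, a cotensoring) over $\mathcal{W}$ given by $x\otimes w := x\otimes Fw$ (respectively, $x^w := x^{Fw}$) for $x\in\mathcal{C}$ and $w\in\mathcal{W}$. (2) If the oplax counit $\varepsilon\colon F(\mathbb{1}_{\mathcal{W}})\to\mathbb{1}_{\mathcal{V}}$ is an isomorphism and the $\mathcal{W}$-category $G_*\mathcal{V}$ admits a tensoring or a cotensoring over $\mathcal{W}$, then $F$ is strong monoidal.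
   Context: For a $\mathcal{V}$-category $\mathcal{C}$ with hom-objects $\underline{\mathcal{C}}(x,y)$, $G_*\mathcal{C}$ is the $\mathcal{W}$-category with the same objects and hom-objects $G(\underline{\mathcal{C}}(x,y))$. $G_*\mathcal{V}$ is this construction applied to $\mathcal{V}$ enriched over itself by its internal hom $\underline{\mathcal{V}}(-,-)$. A $\mathcal{V}$-category $\mathcal{C}$ is tensored over $\mathcal{V}$ if for all $v\in\mathcal{V}$, $x\in\mathcal{C}$ there is an object $x\otimes v\in\mathcal{C}$ with isomorphisms $\underline{\mathcal{C}}(x\otimes v,y)\cong\underline{\mathcal{V}}(v,\underline{\mathcal{C}}(x,y))$ in $\mathcal{V}$, $\mathcal{V}$-natural in $y$; it is cotensored if for all $v\in\mathcal{V}$, $y\in\mathcal{C}$ there is an object $y^v$ with isomorphisms $\underline{\mathcal{C}}(x,y^v)\cong\underline{\mathcal{V}}(v,\underline{\mathcal{C}}(x,y))$, $\mathcal{V}$-natural in $x$. Given a lax monoidal structure on the right adjoint $G$, the left adjoint $F$ has a corresponding oplax monoidal structure $\delta_{x,y}\colon F(x\otimes y)\to F(x)\otimes F(y)$, $\varepsilon\colon F(\mathbb{1}_{\mathcal{W}})\to\mathbb{1}_{\mathcal{V}}$ (doctrinal adjunction); $F$ is strong monoidal if all $\delta_{x,y}$ and $\varepsilon$ are isomorphisms. *)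

theory Defs
  imports Main
begin

section \<open>Closed symmetric monoidal categories\<close>

text \<open>
  All operations are total HOL functions; they are only constrained on (and only ever used at)
  objects and arrows of the category and composable pairs. Composition is written in
  applicative order, so \<open>g \<cdot> f\<close> means first \<open>f\<close>, then \<open>g\<close>.
\<close>

record ('o, 'a) category =
  Obj :: "'o set"
  Arr :: "'a set"
  Dom :: "'a \<Rightarrow> 'o"
  Cod :: "'a \<Rightarrow> 'o"
  Ident :: "'o \<Rightarrow> 'a"
  Comp :: "'a \<Rightarrow> 'a \<Rightarrow> 'a" (infixr "\<cdot>\<index>" 55)

definition hom :: "('o, 'a, 'm) category_scheme \<Rightarrow> 'o \<Rightarrow> 'o \<Rightarrow> 'a set" where
  "hom C x y = {f \<in> Arr C. Dom C f = x \<and> Cod C f = y}"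

definition inverse_arrows :: "('o, 'a, 'm) category_scheme \<Rightarrow> 'a \<Rightarrow> 'a \<Rightarrow> bool" where
  "inverse_arrows C f g \<longleftrightarrow>
     f \<in> Arr C \<and> g \<in> hom C (Cod C f) (Dom C f) \<and>
     g \<cdot>\<^bsub>C\<^esub> f = Ident C (Dom C f) \<and> f \<cdot>\<^bsub>C\<^esub> g = Ident C (Cod C f)"

definition iso :: "('o, 'a, 'm) category_scheme \<Rightarrow> 'a \<Rightarrow> bool" where
  "iso C f \<longleftrightarrow> (\<exists>g. inverse_arrows C f g)"

definition inverse_of :: "('o, 'a, 'm) category_scheme \<Rightarrow> 'a \<Rightarrow> 'a" where
  "inverse_of C f = (THE g. inverse_arrows C f g)"

locale category =
  fixes C :: "('o, 'a, 'm) category_scheme" (structure)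
  assumes Dom_in_Obj: "f \<in> Arr C \<Longrightarrow> Dom C f \<in> Obj C"
    and Cod_in_Obj: "f \<in> Arr C \<Longrightarrow> Cod C f \<in> Obj C"
    and Ident_in_hom: "x \<in> Obj C \<Longrightarrow> Ident C x \<in> hom C x x"
    and Comp_in_hom: "\<lbrakk>f \<in> hom C x y; g \<in> hom C y z\<rbrakk> \<Longrightarrow> g \<cdot> f \<in> hom C x z"
    and Comp_Ident: "f \<in> hom C x y \<Longrightarrow> f \<cdot> Ident C x = f"
    and Ident_Comp: "f \<in> hom C x y \<Longrightarrow> Ident C y \<cdot> f = f"
    and Comp_assoc: "\<lbrakk>f \<in> hom C w x; g \<in> hom C x y; h \<in> hom C y z\<rbrakk>
           \<Longrightarrow> (h \<cdot> g) \<cdot> f = h \<cdot> (g \<cdot> f)"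

record ('o, 'a) monoidal_category = "('o, 'a) category" +
  Unit :: 'o ("\<one>\<index>")
  TensorO :: "'o \<Rightarrow> 'o \<Rightarrow> 'o" (infixl "\<otimes>\<index>" 70)
  TensorA :: "'a \<Rightarrow> 'a \<Rightarrow> 'a" (infixl "\<otimes>\<^sub>a\<index>" 70)
  Assoc :: "'o \<Rightarrow> 'o \<Rightarrow> 'o \<Rightarrow> 'a"
  LUnit :: "'o \<Rightarrow> 'a"
  RUnit :: "'o \<Rightarrow> 'a"

locale monoidal_category = category V
  for V :: "('o, 'a, 'm) monoidal_category_scheme" (structure) +
  assumes Unit_in_Obj: "\<one> \<in> Obj V"
    and TensorO_in_Obj: "\<lbrakk>x \<in> Obj V; y \<in> Obj V\<rbrakk> \<Longrightarrow> x \<otimes> y \<in> Obj V"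
    and TensorA_in_hom: "\<lbrakk>f \<in> hom V x x'; g \<in> hom V y y'\<rbrakk>
           \<Longrightarrow> f \<otimes>\<^sub>a g \<in> hom V (x \<otimes> y) (x' \<otimes> y')"
    and TensorA_Ident: "\<lbrakk>x \<in> Obj V; y \<in> Obj V\<rbrakk>
           \<Longrightarrow> Ident V x \<otimes>\<^sub>a Ident V y = Ident V (x \<otimes> y)"
    and TensorA_Comp: "\<lbrakk>f \<in> hom V x x'; f' \<in> hom V x' x''; g \<in> hom V y y'; g' \<in> hom V y' y''\<rbrakk>
           \<Longrightarrow> (f' \<cdot> f) \<otimes>\<^sub>a (g' \<cdot> g) = (f' \<otimes>\<^sub>a g') \<cdot> (f \<otimes>\<^sub>a g)"
    and Assoc_in_hom: "\<lbrakk>x \<in> Obj V; y \<in> Obj V; z \<in> Obj V\<rbrakk>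
           \<Longrightarrow> Assoc V x y z \<in> hom V ((x \<otimes> y) \<otimes> z) (x \<otimes> (y \<otimes> z))"
    and Assoc_iso: "\<lbrakk>x \<in> Obj V; y \<in> Obj V; z \<in> Obj V\<rbrakk> \<Longrightarrow> iso V (Assoc V x y z)"
    and Assoc_natural: "\<lbrakk>f \<in> hom V x x'; g \<in> hom V y y'; h \<in> hom V z z'\<rbrakk>
           \<Longrightarrow> Assoc V x' y' z' \<cdot> ((f \<otimes>\<^sub>a g) \<otimes>\<^sub>a h) = (f \<otimes>\<^sub>a (g \<otimes>\<^sub>a h)) \<cdot> Assoc V x y z"
    and LUnit_in_hom: "x \<in> Obj V \<Longrightarrow> LUnit V x \<in> hom V (\<one> \<otimes> x) x"
    and LUnit_iso: "x \<in> Obj V \<Longrightarrow> iso V (LUnit V x)"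
    and LUnit_natural: "f \<in> hom V x x' \<Longrightarrow> LUnit V x' \<cdot> (Ident V \<one> \<otimes>\<^sub>a f) = f \<cdot> LUnit V x"
    and RUnit_in_hom: "x \<in> Obj V \<Longrightarrow> RUnit V x \<in> hom V (x \<otimes> \<one>) x"
    and RUnit_iso: "x \<in> Obj V \<Longrightarrow> iso V (RUnit V x)"
    and RUnit_natural: "f \<in> hom V x x' \<Longrightarrow> RUnit V x' \<cdot> (f \<otimes>\<^sub>a Ident V \<one>) = f \<cdot> RUnit V x"
    and pentagon: "\<lbrakk>w \<in> Obj V; x \<in> Obj V; y \<in> Obj V; z \<in> Obj V\<rbrakk>
           \<Longrightarrow> Assoc V w x (y \<otimes> z) \<cdot> Assoc V (w \<otimes> x) y z =
               (Ident V w \<otimes>\<^sub>a Assoc V x y z) \<cdot> Assoc V w (x \<otimes> y) z \<cdot> (Assoc V w x y \<otimes>\<^sub>a Ident V z)"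
    and triangle: "\<lbrakk>x \<in> Obj V; y \<in> Obj V\<rbrakk>
           \<Longrightarrow> (Ident V x \<otimes>\<^sub>a LUnit V y) \<cdot> Assoc V x \<one> y = RUnit V x \<otimes>\<^sub>a Ident V y"

record ('o, 'a) symmetric_monoidal_category = "('o, 'a) monoidal_category" +
  Braid :: "'o \<Rightarrow> 'o \<Rightarrow> 'a"

locale symmetric_monoidal_category = monoidal_category V
  for V :: "('o, 'a, 'm) symmetric_monoidal_category_scheme" (structure) +
  assumes Braid_in_hom: "\<lbrakk>x \<in> Obj V; y \<in> Obj V\<rbrakk> \<Longrightarrow> Braid V x y \<in> hom V (x \<otimes> y) (y \<otimes> x)"
    and Braid_natural: "\<lbrakk>f \<in> hom V x x'; g \<in> hom V y y'\<rbrakk>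
           \<Longrightarrow> Braid V x' y' \<cdot> (f \<otimes>\<^sub>a g) = (g \<otimes>\<^sub>a f) \<cdot> Braid V x y"
    and Braid_symmetric: "\<lbrakk>x \<in> Obj V; y \<in> Obj V\<rbrakk>
           \<Longrightarrow> Braid V y x \<cdot> Braid V x y = Ident V (x \<otimes> y)"
    and hexagon: "\<lbrakk>x \<in> Obj V; y \<in> Obj V; z \<in> Obj V\<rbrakk>
           \<Longrightarrow> Assoc V y z x \<cdot> Braid V x (y \<otimes> z) \<cdot> Assoc V x y z =
               (Ident V y \<otimes>\<^sub>a Braid V x z) \<cdot> Assoc V y x z \<cdot> (Braid V x y \<otimes>\<^sub>a Ident V z)"

text \<open>
  \<open>IHom V v x\<close> is the internal hom \<open>[v, x]\<close>, and \<open>Eval V v x\<close> is the evaluation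
  \<open>[v, x] \<otimes> v \<rightarrow> x\<close>, i.e. the counit of the adjunction between \<open>- \<otimes> v\<close> and \<open>[v, -]\<close>.
\<close>

record ('o, 'a) closed_symmetric_monoidal_category = "('o, 'a) symmetric_monoidal_category" +
  IHom :: "'o \<Rightarrow> 'o \<Rightarrow> 'o"
  Eval :: "'o \<Rightarrow> 'o \<Rightarrow> 'a"

locale closed_symmetric_monoidal_category = symmetric_monoidal_category V
  for V :: "('o, 'a, 'm) closed_symmetric_monoidal_category_scheme" (structure) +
  assumes IHom_in_Obj: "\<lbrakk>v \<in> Obj V; x \<in> Obj V\<rbrakk> \<Longrightarrow> IHom V v x \<in> Obj V"
    and Eval_in_hom: "\<lbrakk>v \<in> Obj V; x \<in> Obj V\<rbrakk> \<Longrightarrow> Eval V v x \<in> hom V (IHom V v x \<otimes> v) x"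
    and Eval_universal: "\<lbrakk>u \<in> Obj V; v \<in> Obj V; x \<in> Obj V; f \<in> hom V (u \<otimes> v) x\<rbrakk>
           \<Longrightarrow> \<exists>!g. g \<in> hom V u (IHom V v x) \<and> Eval V v x \<cdot> (g \<otimes>\<^sub>a Ident V v) = f"

definition curry_arrow ::
  "('o, 'a, 'm) closed_symmetric_monoidal_category_scheme \<Rightarrow> 'o \<Rightarrow> 'o \<Rightarrow> 'o \<Rightarrow> 'a \<Rightarrow> 'a" where
  "curry_arrow V u v x f =
     (THE g. g \<in> hom V u (IHom V v x) \<and> Eval V v x \<cdot>\<^bsub>V\<^esub> (g \<otimes>\<^sub>a\<^bsub>V\<^esub> Ident V v) = f)"


section \<open>Functors, adjunctions and monoidal structures on functors\<close>

record ('o, 'a, 'p, 'b) functor_data =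
  FObj :: "'o \<Rightarrow> 'p"
  FArr :: "'a \<Rightarrow> 'b"

locale cat_functor = C: category C + D: category D
  for C :: "('o, 'a, 'm) category_scheme"
    and D :: "('p, 'b, 'n) category_scheme"
    and F :: "('o, 'a, 'p, 'b, 'k) functor_data_scheme" +
  assumes FObj_in_Obj: "x \<in> Obj C \<Longrightarrow> FObj F x \<in> Obj D"
    and FArr_in_hom: "f \<in> hom C x y \<Longrightarrow> FArr F f \<in> hom D (FObj F x) (FObj F y)"
    and FArr_Ident: "x \<in> Obj C \<Longrightarrow> FArr F (Ident C x) = Ident D (FObj F x)"
    and FArr_Comp: "\<lbrakk>f \<in> hom C x y; g \<in> hom C y z\<rbrakk>
           \<Longrightarrow> FArr F (g \<cdot>\<^bsub>C\<^esub> f) = FArr F g \<cdot>\<^bsub>D\<^esub> FArr F f"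

text \<open>
  \<open>F : W \<rightarrow> V\<close> is left adjoint to \<open>G : V \<rightarrow> W\<close> with unit \<open>\<eta>\<close> and counit \<open>\<kappa>\<close>
  (the letter \<open>\<epsilon>\<close> being reserved for the oplax counit below).
\<close>

locale adjunction = F: cat_functor W V F + G: cat_functor V W G
  for W :: "('w, 'b, 'n) category_scheme"
    and V :: "('v, 'a, 'm) category_scheme"
    and F :: "('w, 'b, 'v, 'a, 'k) functor_data_scheme"
    and G :: "('v, 'a, 'w, 'b, 'l) functor_data_scheme"
    and \<eta> :: "'w \<Rightarrow> 'b"
    and \<kappa> :: "'v \<Rightarrow> 'a" +
  assumes unit_in_hom: "w \<in> Obj W \<Longrightarrow> \<eta> w \<in> hom W w (FObj G (FObj F w))"
    and unit_natural: "f \<in> hom W w w' \<Longrightarrow> \<eta> w' \<cdot>\<^bsub>W\<^esub> f = FArr G (FArr F f) \<cdot>\<^bsub>W\<^esub> \<eta> w"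
    and counit_in_hom: "v \<in> Obj V \<Longrightarrow> \<kappa> v \<in> hom V (FObj F (FObj G v)) v"
    and counit_natural: "g \<in> hom V v v' \<Longrightarrow> \<kappa> v' \<cdot>\<^bsub>V\<^esub> FArr F (FArr G g) = g \<cdot>\<^bsub>V\<^esub> \<kappa> v"
    and triangle_left: "w \<in> Obj W
           \<Longrightarrow> \<kappa> (FObj F w) \<cdot>\<^bsub>V\<^esub> FArr F (\<eta> w) = Ident V (FObj F w)"
    and triangle_right: "v \<in> Obj V
           \<Longrightarrow> FArr G (\<kappa> v) \<cdot>\<^bsub>W\<^esub> \<eta> (FObj G v) = Ident W (FObj G v)"

record ('o, 'a, 'p, 'b) lax_functor_data = "('o, 'a, 'p, 'b) functor_data" +
  LaxMult :: "'o \<Rightarrow> 'o \<Rightarrow> 'b"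
  LaxUnit :: "'b"

locale lax_monoidal_functor =
  V: monoidal_category V + W: monoidal_category W + cat_functor V W G
  for V :: "('v, 'a, 'm) monoidal_category_scheme"
    and W :: "('w, 'b, 'n) monoidal_category_scheme"
    and G :: "('v, 'a, 'w, 'b, 'l) lax_functor_data_scheme" +
  assumes LaxMult_in_hom: "\<lbrakk>x \<in> Obj V; y \<in> Obj V\<rbrakk>
           \<Longrightarrow> LaxMult G x y \<in> hom W (FObj G x \<otimes>\<^bsub>W\<^esub> FObj G y) (FObj G (x \<otimes>\<^bsub>V\<^esub> y))"
    and LaxMult_natural: "\<lbrakk>f \<in> hom V x x'; g \<in> hom V y y'\<rbrakk>
           \<Longrightarrow> LaxMult G x' y' \<cdot>\<^bsub>W\<^esub> (FArr G f \<otimes>\<^sub>a\<^bsub>W\<^esub> FArr G g) =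
               FArr G (f \<otimes>\<^sub>a\<^bsub>V\<^esub> g) \<cdot>\<^bsub>W\<^esub> LaxMult G x y"
    and LaxUnit_in_hom: "LaxUnit G \<in> hom W \<one>\<^bsub>W\<^esub> (FObj G \<one>\<^bsub>V\<^esub>)"
    and Lax_assoc: "\<lbrakk>x \<in> Obj V; y \<in> Obj V; z \<in> Obj V\<rbrakk>
           \<Longrightarrow> FArr G (Assoc V x y z) \<cdot>\<^bsub>W\<^esub> LaxMult G (x \<otimes>\<^bsub>V\<^esub> y) z
                 \<cdot>\<^bsub>W\<^esub> (LaxMult G x y \<otimes>\<^sub>a\<^bsub>W\<^esub> Ident W (FObj G z)) =
               LaxMult G x (y \<otimes>\<^bsub>V\<^esub> z) \<cdot>\<^bsub>W\<^esub> (Ident W (FObj G x) \<otimes>\<^sub>a\<^bsub>W\<^esub> LaxMult G y z)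
                 \<cdot>\<^bsub>W\<^esub> Assoc W (FObj G x) (FObj G y) (FObj G z)"
    and Lax_lunit: "x \<in> Obj V
           \<Longrightarrow> FArr G (LUnit V x) \<cdot>\<^bsub>W\<^esub> LaxMult G \<one>\<^bsub>V\<^esub> x
                 \<cdot>\<^bsub>W\<^esub> (LaxUnit G \<otimes>\<^sub>a\<^bsub>W\<^esub> Ident W (FObj G x)) = LUnit W (FObj G x)"
    and Lax_runit: "x \<in> Obj V
           \<Longrightarrow> FArr G (RUnit V x) \<cdot>\<^bsub>W\<^esub> LaxMult G x \<one>\<^bsub>V\<^esub>
                 \<cdot>\<^bsub>W\<^esub> (Ident W (FObj G x) \<otimes>\<^sub>a\<^bsub>W\<^esub> LaxUnit G) = RUnit W (FObj G x)"

text \<open>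
  The oplax structure on the left adjoint given by doctrinal adjunction: the mates
  \<open>F (x \<otimes> y) \<rightarrow> F (G (F x) \<otimes> G (F y)) \<rightarrow> F (G (F x \<otimes> F y)) \<rightarrow> F x \<otimes> F y\<close>
  and \<open>F \<one> \<rightarrow> F (G \<one>) \<rightarrow> \<one>\<close> of the lax structure maps of \<open>G\<close>.
\<close>

definition oplax_mult ::
  "('w, 'b, 'n) monoidal_category_scheme \<Rightarrow> ('v, 'a, 'm) monoidal_category_scheme \<Rightarrow>
   ('w, 'b, 'v, 'a, 'k) functor_data_scheme \<Rightarrow> ('v, 'a, 'w, 'b, 'l) lax_functor_data_scheme \<Rightarrow>
   ('w \<Rightarrow> 'b) \<Rightarrow> ('v \<Rightarrow> 'a) \<Rightarrow> 'w \<Rightarrow> 'w \<Rightarrow> 'a" where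
  "oplax_mult W V F G \<eta> \<kappa> x y =
     \<kappa> (FObj F x \<otimes>\<^bsub>V\<^esub> FObj F y) \<cdot>\<^bsub>V\<^esub> FArr F (LaxMult G (FObj F x) (FObj F y))
       \<cdot>\<^bsub>V\<^esub> FArr F (\<eta> x \<otimes>\<^sub>a\<^bsub>W\<^esub> \<eta> y)"

definition oplax_counit ::
  "('v, 'a, 'm) monoidal_category_scheme \<Rightarrow>
   ('w, 'b, 'v, 'a, 'k) functor_data_scheme \<Rightarrow> ('v, 'a, 'w, 'b, 'l) lax_functor_data_scheme \<Rightarrow>
   ('v \<Rightarrow> 'a) \<Rightarrow> 'a" where
  "oplax_counit V F G \<kappa> = \<kappa> \<one>\<^bsub>V\<^esub> \<cdot>\<^bsub>V\<^esub> FArr F (LaxUnit G)"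

definition left_adjoint_strong_monoidal ::
  "('w, 'b, 'n) monoidal_category_scheme \<Rightarrow> ('v, 'a, 'm) monoidal_category_scheme \<Rightarrow>
   ('w, 'b, 'v, 'a, 'k) functor_data_scheme \<Rightarrow> ('v, 'a, 'w, 'b, 'l) lax_functor_data_scheme \<Rightarrow>
   ('w \<Rightarrow> 'b) \<Rightarrow> ('v \<Rightarrow> 'a) \<Rightarrow> bool" where
  "left_adjoint_strong_monoidal W V F G \<eta> \<kappa> \<longleftrightarrow>
     (\<forall>x\<in>Obj W. \<forall>y\<in>Obj W. iso V (oplax_mult W V F G \<eta> \<kappa> x y)) \<and>
     iso V (oplax_counit V F G \<kappa>)"


section \<open>Enriched categories\<close>

text \<open>
  \<open>EComp C x y z\<close> is the composition \<open>C(y, z) \<otimes> C(x, y) \<rightarrow> C(x, z)\<close>, and \<open>EId C x\<close> is the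
  identity element \<open>\<one> \<rightarrow> C(x, x)\<close>.
\<close>

record ('c, 'o, 'a) enriched_category =
  EObj :: "'c set"
  EHom :: "'c \<Rightarrow> 'c \<Rightarrow> 'o"
  EId :: "'c \<Rightarrow> 'a"
  EComp :: "'c \<Rightarrow> 'c \<Rightarrow> 'c \<Rightarrow> 'a"

locale enriched_category = monoidal_category V
  for V :: "('o, 'a, 'm) monoidal_category_scheme" (structure)
    and C :: "('c, 'o, 'a, 'k) enriched_category_scheme" +
  assumes EHom_in_Obj: "\<lbrakk>x \<in> EObj C; y \<in> EObj C\<rbrakk> \<Longrightarrow> EHom C x y \<in> Obj V"
    and EId_in_hom: "x \<in> EObj C \<Longrightarrow> EId C x \<in> hom V \<one> (EHom C x x)"
    and EComp_in_hom: "\<lbrakk>x \<in> EObj C; y \<in> EObj C; z \<in> EObj C\<rbrakk>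
           \<Longrightarrow> EComp C x y z \<in> hom V (EHom C y z \<otimes> EHom C x y) (EHom C x z)"
    and EComp_assoc: "\<lbrakk>w \<in> EObj C; x \<in> EObj C; y \<in> EObj C; z \<in> EObj C\<rbrakk>
           \<Longrightarrow> EComp C w x z \<cdot> (EComp C x y z \<otimes>\<^sub>a Ident V (EHom C w x)) =
               EComp C w y z \<cdot> (Ident V (EHom C y z) \<otimes>\<^sub>a EComp C w x y)
                 \<cdot> Assoc V (EHom C y z) (EHom C x y) (EHom C w x)"
    and EId_EComp: "\<lbrakk>x \<in> EObj C; y \<in> EObj C\<rbrakk>
           \<Longrightarrow> EComp C x y y \<cdot> (EId C y \<otimes>\<^sub>a Ident V (EHom C x y)) = LUnit V (EHom C x y)"
    and EComp_EId: "\<lbrakk>x \<in> EObj C; y \<in> EObj C\<rbrakk>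
           \<Longrightarrow> EComp C x x y \<cdot> (Ident V (EHom C x y) \<otimes>\<^sub>a EId C x) = RUnit V (EHom C x y)"

text \<open>The enrichment of \<open>V\<close> over itself; its composition \<open>[y, z] \<otimes> [x, y] \<rightarrow> [x, z]\<close> is the
  transpose of the iterated evaluation.\<close>

definition self_enriched ::
  "('o, 'a, 'm) closed_symmetric_monoidal_category_scheme \<Rightarrow> ('o, 'o, 'a) enriched_category" where
  "self_enriched V =
     \<lparr>EObj = Obj V,
      EHom = IHom V,
      EId = (\<lambda>x. curry_arrow V \<one>\<^bsub>V\<^esub> x x (LUnit V x)),
      EComp = (\<lambda>x y z. curry_arrow V (IHom V y z \<otimes>\<^bsub>V\<^esub> IHom V x y) x z
                 (Eval V y z \<cdot>\<^bsub>V\<^esub> (Ident V (IHom V y z) \<otimes>\<^sub>a\<^bsub>V\<^esub> Eval V x y)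
                    \<cdot>\<^bsub>V\<^esub> Assoc V (IHom V y z) (IHom V x y) x))\<rparr>"

definition opposite ::
  "('o, 'a, 'm) symmetric_monoidal_category_scheme \<Rightarrow> ('c, 'o, 'a, 'k) enriched_category_scheme \<Rightarrow>
   ('c, 'o, 'a) enriched_category" where
  "opposite V C =
     \<lparr>EObj = EObj C,
      EHom = (\<lambda>x y. EHom C y x),
      EId = EId C,
      EComp = (\<lambda>x y z. EComp C z y x \<cdot>\<^bsub>V\<^esub> Braid V (EHom C z y) (EHom C y x))\<rparr>"

text \<open>The \<open>W\<close>-category \<open>G\<^sub>*C\<close> obtained from a \<open>V\<close>-category \<open>C\<close> and a lax monoidal \<open>G : V \<rightarrow> W\<close>.\<close>

definition change_of_base ::
  "('w, 'b, 'n) monoidal_category_scheme \<Rightarrow> ('v, 'a, 'w, 'b, 'l) lax_functor_data_scheme \<Rightarrow>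
   ('c, 'v, 'a, 'k) enriched_category_scheme \<Rightarrow> ('c, 'w, 'b) enriched_category" where
  "change_of_base W G C =
     \<lparr>EObj = EObj C,
      EHom = (\<lambda>x y. FObj G (EHom C x y)),
      EId = (\<lambda>x. FArr G (EId C x) \<cdot>\<^bsub>W\<^esub> LaxUnit G),
      EComp = (\<lambda>x y z. FArr G (EComp C x y z) \<cdot>\<^bsub>W\<^esub> LaxMult G (EHom C y z) (EHom C x y))\<rparr>"


section \<open>Enriched functors and natural transformations\<close>

text \<open>\<open>EFArr T x y\<close> is the action \<open>C(x, y) \<rightarrow> D(T x, T y)\<close> on hom-objects.\<close>

record ('c, 'd, 'a) enriched_functor_data =
  EFObj :: "'c \<Rightarrow> 'd"
  EFArr :: "'c \<Rightarrow> 'c \<Rightarrow> 'a"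

definition enriched_compose ::
  "('o, 'a, 'm) category_scheme \<Rightarrow> ('d, 'e, 'a) enriched_functor_data \<Rightarrow> ('c, 'd, 'a) enriched_functor_data \<Rightarrow>
   ('c, 'e, 'a) enriched_functor_data" where
  "enriched_compose V S T =
     \<lparr>EFObj = (\<lambda>x. EFObj S (EFObj T x)),
      EFArr = (\<lambda>x y. EFArr S (EFObj T x) (EFObj T y) \<cdot>\<^bsub>V\<^esub> EFArr T x y)\<rparr>"

text \<open>The representable functor \<open>C(x, -) : C \<rightarrow> V\<close>; its action \<open>C(y, z) \<rightarrow> [C(x, y), C(x, z)]\<close>
  is the transpose of composition.\<close>

definition representable ::
  "('o, 'a, 'm) closed_symmetric_monoidal_category_scheme \<Rightarrow>
   ('c, 'o, 'a, 'k) enriched_category_scheme \<Rightarrow> 'c \<Rightarrow> ('c, 'o, 'a) enriched_functor_data" where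
  "representable V C x =
     \<lparr>EFObj = EHom C x,
      EFArr = (\<lambda>y z. curry_arrow V (EHom C y z) (EHom C x y) (EHom C x z) (EComp C x y z))\<rparr>"

text \<open>
  A natural transformation \<open>S \<Rightarrow> T\<close> of \<open>V\<close>-functors \<open>C \<rightarrow> D\<close> has components
  \<open>\<alpha> x : \<one> \<rightarrow> D(S x, T x)\<close>, and naturality equates two arrows \<open>C(x, y) \<rightarrow> D(S x, T y)\<close>.
  Functoriality of \<open>S\<close> and \<open>T\<close> is not part of the condition; it is only applied to composites of
  representables.
\<close>

definition enriched_natural ::
  "('o, 'a, 'm) monoidal_category_scheme \<Rightarrow>
   ('c, 'o, 'a, 'k) enriched_category_scheme \<Rightarrow> ('d, 'o, 'a, 'l) enriched_category_scheme \<Rightarrow>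
   ('c, 'd, 'a) enriched_functor_data \<Rightarrow> ('c, 'd, 'a) enriched_functor_data \<Rightarrow> ('c \<Rightarrow> 'a) \<Rightarrow> bool" where
  "enriched_natural V C D S T \<alpha> \<longleftrightarrow>
     (\<forall>x\<in>EObj C. \<alpha> x \<in> hom V \<one>\<^bsub>V\<^esub> (EHom D (EFObj S x) (EFObj T x))) \<and>
     (\<forall>x\<in>EObj C. \<forall>y\<in>EObj C.
        EComp D (EFObj S x) (EFObj S y) (EFObj T y) \<cdot>\<^bsub>V\<^esub> (\<alpha> y \<otimes>\<^sub>a\<^bsub>V\<^esub> EFArr S x y)
          \<cdot>\<^bsub>V\<^esub> inverse_of V (LUnit V (EHom C x y)) =
        EComp D (EFObj S x) (EFObj T x) (EFObj T y) \<cdot>\<^bsub>V\<^esub> (EFArr T x y \<otimes>\<^sub>a\<^bsub>V\<^esub> \<alpha> x)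
          \<cdot>\<^bsub>V\<^esub> inverse_of V (RUnit V (EHom C x y)))"

text \<open>For an arrow \<open>f : x \<rightarrow> y\<close> of \<open>V\<close>, the element \<open>\<one> \<rightarrow> [x, y]\<close> it corresponds to.\<close>

definition name_arrow ::
  "('o, 'a, 'm) closed_symmetric_monoidal_category_scheme \<Rightarrow> 'a \<Rightarrow> 'a" where
  "name_arrow V f = curry_arrow V \<one>\<^bsub>V\<^esub> (Dom V f) (Cod V f) (f \<cdot>\<^bsub>V\<^esub> LUnit V (Dom V f))"

text \<open>Isomorphisms \<open>\<phi> x : S x \<rightarrow> T x\<close> in \<open>V\<close>, \<open>V\<close>-natural in \<open>x\<close>, for \<open>S\<close>, \<open>T\<close> from \<open>C\<close> to \<open>V\<close>.\<close>

definition natural_isos ::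
  "('o, 'a, 'm) closed_symmetric_monoidal_category_scheme \<Rightarrow>
   ('c, 'o, 'a, 'k) enriched_category_scheme \<Rightarrow>
   ('c, 'o, 'a) enriched_functor_data \<Rightarrow> ('c, 'o, 'a) enriched_functor_data \<Rightarrow> ('c \<Rightarrow> 'a) \<Rightarrow> bool" where
  "natural_isos V C S T \<phi> \<longleftrightarrow>
     (\<forall>x\<in>EObj C. \<phi> x \<in> hom V (EFObj S x) (EFObj T x) \<and> iso V (\<phi> x)) \<and>
     enriched_natural V C (self_enriched V) S T (\<lambda>x. name_arrow V (\<phi> x))"


section \<open>Tensorings and cotensorings\<close>

text \<open>The object \<open>t\<close> is a tensor \<open>x \<otimes> v\<close>: there are isomorphisms \<open>C(t, y) \<cong> [v, C(x, y)]\<close>,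
  natural in \<open>y \<in> C\<close>.\<close>

definition is_tensor ::
  "('o, 'a, 'm) closed_symmetric_monoidal_category_scheme \<Rightarrow>
   ('c, 'o, 'a, 'k) enriched_category_scheme \<Rightarrow> 'c \<Rightarrow> 'o \<Rightarrow> 'c \<Rightarrow> bool" where
  "is_tensor V C x v t \<longleftrightarrow>
     t \<in> EObj C \<and>
     (\<exists>\<phi>. natural_isos V C
            (representable V C t)
            (enriched_compose V (representable V (self_enriched V) v) (representable V C x)) \<phi>)"

text \<open>The object \<open>t\<close> is a cotensor \<open>y\<^sup>v\<close>: there are isomorphisms \<open>C(x, t) \<cong> [v, C(x, y)]\<close>,
  natural in \<open>x \<in> C\<close>. The contravariant functor \<open>C(-, z)\<close> is represented by \<open>z\<close> on the
  opposite category.\<close>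

definition is_cotensor ::
  "('o, 'a, 'm) closed_symmetric_monoidal_category_scheme \<Rightarrow>
   ('c, 'o, 'a, 'k) enriched_category_scheme \<Rightarrow> 'c \<Rightarrow> 'o \<Rightarrow> 'c \<Rightarrow> bool" where
  "is_cotensor V C y v t \<longleftrightarrow>
     t \<in> EObj C \<and>
     (\<exists>\<phi>. natural_isos V (opposite V C)
            (representable V (opposite V C) t)
            (enriched_compose V (representable V (self_enriched V) v)
               (representable V (opposite V C) y)) \<phi>)"

definition tensoring ::
  "('o, 'a, 'm) closed_symmetric_monoidal_category_scheme \<Rightarrow>
   ('c, 'o, 'a, 'k) enriched_category_scheme \<Rightarrow> ('c \<Rightarrow> 'o \<Rightarrow> 'c) \<Rightarrow> bool" where
  "tensoring V C T \<longleftrightarrow> (\<forall>x\<in>EObj C. \<forall>v\<in>Obj V. is_tensor V C x v (T x v))"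

definition cotensoring ::
  "('o, 'a, 'm) closed_symmetric_monoidal_category_scheme \<Rightarrow>
   ('c, 'o, 'a, 'k) enriched_category_scheme \<Rightarrow> ('c \<Rightarrow> 'o \<Rightarrow> 'c) \<Rightarrow> bool" where
  "cotensoring V C T \<longleftrightarrow> (\<forall>y\<in>EObj C. \<forall>v\<in>Obj V. is_cotensor V C y v (T y v))"

end

theory Submission
  imports Defs
begin

text \<open>
  Everything rests on an enriched Yoneda lemma. A tensor of \<open>x\<close> by \<open>v\<close> in an enriched category \<open>C\<close> is
  the same thing as an object \<open>t\<close> together with an element \<open>u : v \<rightarrow> C(x, t)\<close> such that, for all \<open>y\<close>
  and \<open>a\<close>, the assignment \<open>f \<mapsto> m (f \<otimes> u)\<close>, where \<open>m\<close> is composition in \<open>C\<close>, is a bijection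
  \<open>Hom(a, C(t, y)) \<cong> Hom(a \<otimes> v, C(x, y))\<close> (lemma \<open>is_tensor_iff\<close>). Dually, a cotensor of \<open>y\<close> by \<open>v\<close> is an
  object \<open>t\<close> with an element \<open>u : v \<rightarrow> C(t, y)\<close> for which \<open>f \<mapsto> m (u \<otimes> f)\<close> is a bijection
  \<open>Hom(a, C(x, t)) \<cong> Hom(v \<otimes> a, C(x, y))\<close> (lemma \<open>is_cotensor_iff\<close>). The cotensor case is the tensor case
  for the opposite category; the symmetry that defines the opposite composition disappears when one
  precomposes with the symmetry \<open>a \<otimes> v \<cong> v \<otimes> a\<close>. Both descriptions are about ordinary hom-sets only.

  Now let \<open>F \<stileturn> G\<close>. Since \<open>\<delta>\<close> is the mate of the lax structure map of \<open>G\<close>, adjuncts turn the lax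
  structure of \<open>G\<close> into precomposition with \<open>\<delta>\<close> (lemma \<open>LaxMult_adjunct\<close>). So an element
  \<open>w \<rightarrow> G C(x, t)\<close> with adjunct \<open>u : F w \<rightarrow> C(x, t)\<close> exhibits \<open>t\<close> as a tensor by \<open>w\<close> in \<open>G\<^sub>*C\<close> if and
  only if all maps \<open>f \<mapsto> m (f \<otimes> u) \<delta>\<close> from \<open>Hom(F a, C(t, y))\<close> to \<open>Hom(F (a \<otimes> w), C(x, y))\<close> are bijective.
  If \<open>\<delta>\<close> is invertible, this follows from the bijections that exhibit \<open>t\<close> as a tensor by \<open>F w\<close> in \<open>C\<close>,
  taken at the objects \<open>F a\<close>. The same holds for cotensors, and this gives the first part.

  For the second part take \<open>C = V\<close> and uncurry. With \<open>x = \<one>\<close> and \<open>v : F w \<otimes> \<one> \<rightarrow> t\<close> the uncurried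
  element, the bijections say that precomposition with
  \<open>F (a \<otimes> w) \<otimes> \<one> \<rightarrow> (F a \<otimes> F w) \<otimes> \<one> \<cong> F a \<otimes> (F w \<otimes> \<one>) \<rightarrow> F a \<otimes> t\<close>, built from \<open>\<delta>\<close> and \<open>v\<close>, is
  bijective into every object, so this composite is invertible by Yoneda. Because \<open>\<epsilon>\<close> is invertible,
  the unit law of the oplax structure makes \<open>\<delta>\<close> invertible when \<open>a = \<one>\<close>; therefore \<open>v\<close> is invertible, and
  then so is \<open>\<delta>\<close> for every \<open>a\<close>. For cotensors the bijections are \<open>g \<mapsto> v (F w \<otimes> g)\<close> followed by
  precomposition with an associator and \<open>\<delta> \<otimes> x\<close>; the case \<open>a = \<one>\<close> shows that the first map
  alone is bijective. Hence precomposition with \<open>\<delta> \<otimes> \<one>\<close> is bijective for every \<open>a\<close>.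
\<close>

section \<open>Isomorphisms and the Yoneda principle\<close>

context category
begin

lemma hom_iff: "f \<in> hom C x y \<longleftrightarrow> f \<in> Arr C \<and> Dom C f = x \<and> Cod C f = y"
  by (simp add: hom_def)

lemma homD:
  assumes "f \<in> hom C x y"
  shows "f \<in> Arr C" "Dom C f = x" "Cod C f = y" "x \<in> Obj C" "y \<in> Obj C"
  using assms Dom_in_Obj Cod_in_Obj by (auto simp: hom_def)

lemma comp_arr [simp]:
  assumes "f \<in> Arr C" "g \<in> Arr C" "Dom C g = Cod C f"
  shows "g \<cdot> f \<in> Arr C" "Dom C (g \<cdot> f) = Dom C f" "Cod C (g \<cdot> f) = Cod C g"
  using Comp_in_hom[of f "Dom C f" "Cod C f" g "Cod C g"] assms by (auto simp: hom_def)

lemma ident_arr [simp]: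
  assumes "x \<in> Obj C"
  shows "Ident C x \<in> Arr C" "Dom C (Ident C x) = x" "Cod C (Ident C x) = x"
  using Ident_in_hom[OF assms] by (auto simp: hom_def)

lemma comp_ident [simp]: "f \<in> Arr C \<Longrightarrow> Dom C f = x \<Longrightarrow> f \<cdot> Ident C x = f"
  using Comp_Ident by (auto simp: hom_def)

lemma ident_comp [simp]: "f \<in> Arr C \<Longrightarrow> Cod C f = x \<Longrightarrow> Ident C x \<cdot> f = f"
  using Ident_Comp by (auto simp: hom_def)

lemma comp_assoc [simp]:
  assumes "f \<in> Arr C" "g \<in> Arr C" "h \<in> Arr C" "Dom C g = Cod C f" "Dom C h = Cod C g"
  shows "(h \<cdot> g) \<cdot> f = h \<cdot> (g \<cdot> f)"
  using Comp_assoc[of f "Dom C f" "Cod C f" g "Cod C g" h "Cod C h"] assms by (auto simp: hom_def)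

text \<open>Composites are kept bracketed to the right, so an equation between composites of two arrows
  has to be extended by an arbitrary tail before it can rewrite the middle of a chain.\<close>

lemma comp_extend:
  assumes "g \<cdot> f = k \<cdot> h" "f \<in> Arr C" "g \<in> Arr C" "Dom C g = Cod C f"
    "h \<in> Arr C" "k \<in> Arr C" "Dom C k = Cod C h" "p \<in> Arr C" "Dom C f = Cod C p"
  shows "g \<cdot> f \<cdot> p = k \<cdot> h \<cdot> p"
proof -
  have "Dom C h = Dom C f"
    using assms comp_arr(2)[of f g] comp_arr(2)[of h k] by simp
  then show ?thesis
    using assms comp_assoc[of p f g] comp_assoc[of p h k] by simp
qed

lemma comp_extend1:
  assumes "g \<cdot> f = k" "f \<in> Arr C" "g \<in> Arr C" "Dom C g = Cod C f" "p \<in> Arr C" "Dom C f = Cod C p"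
  shows "g \<cdot> f \<cdot> p = k \<cdot> p"
  using assms comp_assoc[of p f g] by simp

lemma inverse_arrows_inverse_of:
  assumes "iso C f"
  shows "inverse_arrows C f (inverse_of C f)"
proof -
  obtain g where g: "inverse_arrows C f g"
    using assms by (auto simp: iso_def)
  have "h = g" if h: "inverse_arrows C f h" for h
  proof -
    have "h = (h \<cdot> f) \<cdot> g"
      using g h by (subst comp_assoc) (auto simp: inverse_arrows_def hom_iff)
    then show ?thesis
      using g h by (auto simp: inverse_arrows_def hom_iff)
  qed
  then show ?thesis
    unfolding inverse_of_def using g by (metis theI)
qed

lemma iso_arr: "iso C f \<Longrightarrow> f \<in> Arr C"
  by (auto simp: iso_def inverse_arrows_def)

lemma inverse_of_arr [simp]:
  assumes "iso C f"
  shows "inverse_of C f \<in> Arr C" "Dom C (inverse_of C f) = Cod C f" "Cod C (inverse_of C f) = Dom C f"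
  using inverse_arrows_inverse_of[OF assms] by (auto simp: inverse_arrows_def hom_iff)

lemma inverse_of_comp [simp]:
  assumes "iso C f"
  shows "inverse_of C f \<cdot> f = Ident C (Dom C f)" "f \<cdot> inverse_of C f = Ident C (Cod C f)"
  using inverse_arrows_inverse_of[OF assms] by (auto simp: inverse_arrows_def)

lemma inverse_of_comp_extended [simp]:
  assumes "iso C f" "h \<in> Arr C"
  shows "Cod C h = Dom C f \<Longrightarrow> inverse_of C f \<cdot> f \<cdot> h = h"
    "Cod C h = Cod C f \<Longrightarrow> f \<cdot> inverse_of C f \<cdot> h = h"
proof -
  show "inverse_of C f \<cdot> f \<cdot> h = h" if "Cod C h = Dom C f"
    using comp_extend1[OF inverse_of_comp(1)] assms iso_arr that by simp
  show "f \<cdot> inverse_of C f \<cdot> h = h" if "Cod C h = Cod C f"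
    using comp_extend1[OF inverse_of_comp(2)] assms iso_arr that by simp
qed

lemma isoI:
  assumes "f \<in> hom C x y" "g \<in> hom C y x" "g \<cdot> f = Ident C x" "f \<cdot> g = Ident C y"
  shows "iso C f"
  unfolding iso_def inverse_arrows_def using assms homD[OF assms(1)] by metis

lemma iso_ident: "x \<in> Obj C \<Longrightarrow> iso C (Ident C x)"
  by (rule isoI[where g = "Ident C x"]) (auto simp: hom_iff)

lemma iso_inverse_of: "iso C f \<Longrightarrow> iso C (inverse_of C f)"
  by (rule isoI[where g = f]) (auto simp: hom_iff iso_arr)

lemma iso_comp:
  assumes "iso C f" "iso C g" "Dom C g = Cod C f"
  shows "iso C (g \<cdot> f)"
  by (rule isoI[where g = "inverse_of C f \<cdot> inverse_of C g"])
    (use assms iso_arr in \<open>auto simp: hom_iff\<close>)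

lemma iso_cancel_right:
  assumes "iso C f" "g \<in> Arr C" "h \<in> Arr C" "Dom C g = Cod C f" "Dom C h = Cod C f" "g \<cdot> f = h \<cdot> f"
  shows "g = h"
proof -
  have "(g \<cdot> f) \<cdot> inverse_of C f = (h \<cdot> f) \<cdot> inverse_of C f"
    by (simp only: assms(6))
  then show ?thesis
    using assms(1-5) iso_arr[OF assms(1)] by simp
qed

lemma iso_cancel_left:
  assumes "iso C f" "g \<in> Arr C" "h \<in> Arr C" "Dom C f = Cod C g" "Dom C f = Cod C h" "f \<cdot> g = f \<cdot> h"
  shows "g = h"
proof -
  have "inverse_of C f \<cdot> f \<cdot> g = inverse_of C f \<cdot> f \<cdot> h"
    by (simp only: assms(6))
  then show ?thesis
    using inverse_of_comp_extended(1)[OF assms(1)] assms(2-5) by metis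
qed

lemma iso_of_comp_left:
  assumes "iso C f" "iso C (g \<cdot> f)" "g \<in> Arr C" "Dom C g = Cod C f"
  shows "iso C g"
proof -
  have "iso C ((g \<cdot> f) \<cdot> inverse_of C f)"
    by (rule iso_comp) (use assms iso_arr[OF assms(1)] iso_inverse_of in auto)
  moreover have "(g \<cdot> f) \<cdot> inverse_of C f = g"
    using assms iso_arr[OF assms(1)] by simp
  ultimately show ?thesis
    by (simp only:)
qed

lemma iso_of_comp_right:
  assumes "iso C g" "iso C (g \<cdot> f)" "f \<in> Arr C" "Dom C g = Cod C f"
  shows "iso C f"
proof -
  have "iso C (inverse_of C g \<cdot> g \<cdot> f)"
    by (rule iso_comp) (use assms iso_arr[OF assms(1)] iso_inverse_of in auto)
  moreover have "inverse_of C g \<cdot> g \<cdot> f = f"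
    using assms by simp
  ultimately show ?thesis
    by (simp only:)
qed

lemma bij_postcompose_iso:
  assumes "iso C k" "k \<in> hom C x y"
  shows "bij_betw (\<lambda>f. k \<cdot> f) (hom C a x) (hom C a y)"
  by (rule bij_betw_byWitness[where f' = "\<lambda>f. inverse_of C k \<cdot> f"]) (use assms in \<open>auto simp: hom_iff\<close>)

lemma bij_precompose_iso:
  assumes "iso C k" "k \<in> hom C x y"
  shows "bij_betw (\<lambda>f. f \<cdot> k) (hom C y a) (hom C x a)"
  by (rule bij_betw_byWitness[where f' = "\<lambda>f. f \<cdot> inverse_of C k"]) (use assms in \<open>auto simp: hom_iff\<close>)

lemma iso_if_bij_postcompose:
  assumes k: "k \<in> hom C x y"
    and bij: "\<And>a. a \<in> Obj C \<Longrightarrow> bij_betw (\<lambda>f. k \<cdot> f) (hom C a x) (hom C a y)"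
  shows "iso C k"
proof -
  note k' = homD[OF k]
  have "Ident C y \<in> (\<lambda>f. k \<cdot> f) ` hom C y x"
    using bij[of y] k' by (auto simp: bij_betw_def hom_iff)
  then obtain g where g: "g \<in> hom C y x" "k \<cdot> g = Ident C y"
    by auto
  have "k \<cdot> (g \<cdot> k) = k \<cdot> Ident C x"
    using g k' comp_assoc[of k g k] by (simp add: hom_iff del: comp_assoc)
  moreover have "g \<cdot> k \<in> hom C x x" "Ident C x \<in> hom C x x"
    using g k' by (auto simp: hom_iff)
  ultimately have "g \<cdot> k = Ident C x"
    using bij_betw_imp_inj_on[OF bij[OF k'(4)]] by (auto dest: inj_onD)
  with g k show ?thesis
    by (intro isoI) auto
qed

lemma iso_if_bij_precompose:
  assumes k: "k \<in> hom C x y"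
    and bij: "\<And>a. a \<in> Obj C \<Longrightarrow> bij_betw (\<lambda>f. f \<cdot> k) (hom C y a) (hom C x a)"
  shows "iso C k"
proof -
  note k' = homD[OF k]
  have "Ident C x \<in> (\<lambda>f. f \<cdot> k) ` hom C y x"
    using bij[of x] k' by (auto simp: bij_betw_def hom_iff)
  then obtain g where g: "g \<in> hom C y x" "g \<cdot> k = Ident C x"
    by auto
  have "(k \<cdot> g) \<cdot> k = Ident C y \<cdot> k"
    using g k' by (simp add: hom_iff)
  moreover have "k \<cdot> g \<in> hom C y y" "Ident C y \<in> hom C y y"
    using g k' by (auto simp: hom_iff)
  ultimately have "k \<cdot> g = Ident C y"
    using bij_betw_imp_inj_on[OF bij[OF k'(5)]] by (auto dest: inj_onD)
  with g k show ?thesis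
    by (intro isoI) auto
qed

end

section \<open>Coherence in monoidal categories\<close>

context monoidal_category
begin

lemma unit_obj [simp]: "\<one> \<in> Obj V"
  by (rule Unit_in_Obj)

lemma tensor_obj [simp]: "x \<in> Obj V \<Longrightarrow> y \<in> Obj V \<Longrightarrow> x \<otimes> y \<in> Obj V"
  by (rule TensorO_in_Obj)

lemma tensor_arr [simp]:
  assumes "f \<in> Arr V" "g \<in> Arr V"
  shows "f \<otimes>\<^sub>a g \<in> Arr V" "Dom V (f \<otimes>\<^sub>a g) = Dom V f \<otimes> Dom V g" "Cod V (f \<otimes>\<^sub>a g) = Cod V f \<otimes> Cod V g"
  using TensorA_in_hom[of f "Dom V f" "Cod V f" g "Dom V g" "Cod V g"] assms by (auto simp: hom_def)

lemma tensor_ident [simp]: "x \<in> Obj V \<Longrightarrow> y \<in> Obj V \<Longrightarrow> Ident V x \<otimes>\<^sub>a Ident V y = Ident V (x \<otimes> y)"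
  by (rule TensorA_Ident)

text \<open>Interchange is used as a rewrite rule that merges consecutive tensor products.\<close>

lemma interchange [simp]:
  assumes "f \<in> Arr V" "f' \<in> Arr V" "g \<in> Arr V" "g' \<in> Arr V"
    "Dom V f' = Cod V f" "Dom V g' = Cod V g"
  shows "(f' \<otimes>\<^sub>a g') \<cdot> (f \<otimes>\<^sub>a g) = (f' \<cdot> f) \<otimes>\<^sub>a (g' \<cdot> g)"
  using TensorA_Comp[of f "Dom V f" "Cod V f" f' "Cod V f'" g "Dom V g" "Cod V g" g' "Cod V g'"] assms
  by (auto simp: hom_def)

lemma interchange_extended [simp]:
  assumes "f \<in> Arr V" "f' \<in> Arr V" "g \<in> Arr V" "g' \<in> Arr V"
    "Dom V f' = Cod V f" "Dom V g' = Cod V g" "h \<in> Arr V" "Cod V h = Dom V f \<otimes> Dom V g"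
  shows "(f' \<otimes>\<^sub>a g') \<cdot> (f \<otimes>\<^sub>a g) \<cdot> h = ((f' \<cdot> f) \<otimes>\<^sub>a (g' \<cdot> g)) \<cdot> h"
  using assms by (intro comp_extend1) auto

lemma Assoc_arr [simp]:
  assumes "x \<in> Obj V" "y \<in> Obj V" "z \<in> Obj V"
  shows "Assoc V x y z \<in> Arr V" "Dom V (Assoc V x y z) = (x \<otimes> y) \<otimes> z"
    "Cod V (Assoc V x y z) = x \<otimes> (y \<otimes> z)" "iso V (Assoc V x y z)"
  using Assoc_in_hom[OF assms] Assoc_iso[OF assms] by (auto simp: hom_def)

lemma LUnit_arr [simp]:
  assumes "x \<in> Obj V"
  shows "LUnit V x \<in> Arr V" "Dom V (LUnit V x) = \<one> \<otimes> x" "Cod V (LUnit V x) = x" "iso V (LUnit V x)"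
  using LUnit_in_hom[OF assms] LUnit_iso[OF assms] by (auto simp: hom_def)

lemma RUnit_arr [simp]:
  assumes "x \<in> Obj V"
  shows "RUnit V x \<in> Arr V" "Dom V (RUnit V x) = x \<otimes> \<one>" "Cod V (RUnit V x) = x" "iso V (RUnit V x)"
  using RUnit_in_hom[OF assms] RUnit_iso[OF assms] by (auto simp: hom_def)

lemma Assoc_naturality:
  assumes "f \<in> Arr V" "g \<in> Arr V" "h \<in> Arr V"
    "Cod V f = x'" "Cod V g = y'" "Cod V h = z'"
  shows "Assoc V x' y' z' \<cdot> ((f \<otimes>\<^sub>a g) \<otimes>\<^sub>a h) =
    (f \<otimes>\<^sub>a (g \<otimes>\<^sub>a h)) \<cdot> Assoc V (Dom V f) (Dom V g) (Dom V h)"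
  using assms by (intro Assoc_natural) (auto simp: hom_def)

lemma LUnit_naturality: "f \<in> Arr V \<Longrightarrow> Cod V f = x \<Longrightarrow> LUnit V x \<cdot> (Ident V \<one> \<otimes>\<^sub>a f) = f \<cdot> LUnit V (Dom V f)"
  by (rule LUnit_natural) (auto simp: hom_def)

lemma RUnit_naturality: "f \<in> Arr V \<Longrightarrow> Cod V f = x \<Longrightarrow> RUnit V x \<cdot> (f \<otimes>\<^sub>a Ident V \<one>) = f \<cdot> RUnit V (Dom V f)"
  by (rule RUnit_natural) (auto simp: hom_def)

lemma unit_tensor_faithful:
  assumes "f \<in> Arr V" "g \<in> Arr V" "Dom V f = Dom V g" "Cod V f = Cod V g"
    "Ident V \<one> \<otimes>\<^sub>a f = Ident V \<one> \<otimes>\<^sub>a g"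
  shows "f = g"
proof (rule iso_cancel_right)
  show "f \<cdot> LUnit V (Dom V f) = g \<cdot> LUnit V (Dom V f)"
    using assms LUnit_naturality[of f "Cod V f"] LUnit_naturality[of g "Cod V f"] by simp
qed (use assms Dom_in_Obj in auto)

lemma tensor_unit_faithful:
  assumes "f \<in> Arr V" "g \<in> Arr V" "Dom V f = Dom V g" "Cod V f = Cod V g"
    "f \<otimes>\<^sub>a Ident V \<one> = g \<otimes>\<^sub>a Ident V \<one>"
  shows "f = g"
proof (rule iso_cancel_right)
  show "f \<cdot> RUnit V (Dom V f) = g \<cdot> RUnit V (Dom V f)"
    using assms RUnit_naturality[of f "Cod V f"] RUnit_naturality[of g "Cod V f"] by simp
qed (use assms Dom_in_Obj in auto)

lemma iso_tensor:
  assumes "iso V f" "iso V g"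
  shows "iso V (f \<otimes>\<^sub>a g)"
  by (rule isoI[where g = "inverse_of V f \<otimes>\<^sub>a inverse_of V g"])
    (use assms iso_arr Dom_in_Obj Cod_in_Obj in \<open>auto simp: hom_def\<close>)

lemma iso_if_unit_tensor_iso:
  assumes "iso V (Ident V \<one> \<otimes>\<^sub>a f)" "f \<in> Arr V"
  shows "iso V f"
proof -
  have "iso V (LUnit V (Cod V f) \<cdot> (Ident V \<one> \<otimes>\<^sub>a f))"
    using assms Cod_in_Obj by (intro iso_comp) auto
  then have "iso V (f \<cdot> LUnit V (Dom V f))"
    using assms LUnit_naturality by simp
  then show ?thesis
    by (rule iso_of_comp_left[rotated]) (use assms Dom_in_Obj in auto)
qed

lemma iso_if_tensor_unit_iso:
  assumes "iso V (f \<otimes>\<^sub>a Ident V \<one>)" "f \<in> Arr V"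
  shows "iso V f"
proof -
  have "iso V (RUnit V (Cod V f) \<cdot> (f \<otimes>\<^sub>a Ident V \<one>))"
    using assms Cod_in_Obj by (intro iso_comp) auto
  then have "iso V (f \<cdot> RUnit V (Dom V f))"
    using assms RUnit_naturality by simp
  then show ?thesis
    by (rule iso_of_comp_left[rotated]) (use assms Dom_in_Obj in auto)
qed

text \<open>Kelly's argument: tensoring with the unit object is faithful, and after tensoring with it the
  equation is the pentagon for \<open>\<one>, \<one>, x, y\<close> with two of its sides rewritten by the triangle identity.\<close>

lemma LUnit_tensor:
  assumes "x \<in> Obj V" "y \<in> Obj V"
  shows "LUnit V (x \<otimes> y) \<cdot> Assoc V \<one> x y = LUnit V x \<otimes>\<^sub>a Ident V y"
proof (rule unit_tensor_faithful)
  let ?a = "Assoc V \<one> (\<one> \<otimes> x) y \<cdot> (Assoc V \<one> \<one> x \<otimes>\<^sub>a Ident V y)"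
  show "Ident V \<one> \<otimes>\<^sub>a (LUnit V (x \<otimes> y) \<cdot> Assoc V \<one> x y) = Ident V \<one> \<otimes>\<^sub>a (LUnit V x \<otimes>\<^sub>a Ident V y)"
  proof (rule iso_cancel_right[where f = ?a])
    show "iso V ?a"
      using assms by (intro iso_comp iso_tensor iso_ident) auto
    have "(Ident V \<one> \<otimes>\<^sub>a (LUnit V (x \<otimes> y) \<cdot> Assoc V \<one> x y)) \<cdot> ?a =
        (Ident V \<one> \<otimes>\<^sub>a LUnit V (x \<otimes> y)) \<cdot> (Ident V \<one> \<otimes>\<^sub>a Assoc V \<one> x y) \<cdot> ?a"
      using assms by simp
    also have "\<dots> = (Ident V \<one> \<otimes>\<^sub>a LUnit V (x \<otimes> y)) \<cdot> Assoc V \<one> \<one> (x \<otimes> y) \<cdot> Assoc V (\<one> \<otimes> \<one>) x y"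
      using assms pentagon[of \<one> \<one> x y] by simp
    also have "\<dots> = (RUnit V \<one> \<otimes>\<^sub>a Ident V (x \<otimes> y)) \<cdot> Assoc V (\<one> \<otimes> \<one>) x y"
      using assms by (intro comp_extend1 triangle) auto
    also have "\<dots> = Assoc V \<one> x y \<cdot> ((RUnit V \<one> \<otimes>\<^sub>a Ident V x) \<otimes>\<^sub>a Ident V y)"
      using assms by (simp add: Assoc_naturality)
    also have "\<dots> = Assoc V \<one> x y \<cdot> ((Ident V \<one> \<otimes>\<^sub>a LUnit V x) \<otimes>\<^sub>a Ident V y)
        \<cdot> (Assoc V \<one> \<one> x \<otimes>\<^sub>a Ident V y)"
      using assms triangle[of \<one> x] by simp
    also have "\<dots> = (Ident V \<one> \<otimes>\<^sub>a (LUnit V x \<otimes>\<^sub>a Ident V y)) \<cdot> ?a"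
      using assms Assoc_naturality[of "Ident V \<one>" "LUnit V x" "Ident V y" \<one> x y]
      by (subst comp_extend[OF Assoc_naturality]) auto
    finally show "(Ident V \<one> \<otimes>\<^sub>a (LUnit V (x \<otimes> y) \<cdot> Assoc V \<one> x y)) \<cdot> ?a =
      (Ident V \<one> \<otimes>\<^sub>a (LUnit V x \<otimes>\<^sub>a Ident V y)) \<cdot> ?a" .
  qed (use assms in auto)
qed (use assms in auto)

end

section \<open>Coherence of the symmetry\<close>

context symmetric_monoidal_category
begin

lemma iso_Braid: "x \<in> Obj V \<Longrightarrow> y \<in> Obj V \<Longrightarrow> iso V (Braid V x y)"
  by (rule isoI[where g = "Braid V y x"]) (auto intro: Braid_in_hom Braid_symmetric)

lemma Braid_arr [simp]:
  assumes "x \<in> Obj V" "y \<in> Obj V"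
  shows "Braid V x y \<in> Arr V" "Dom V (Braid V x y) = x \<otimes> y" "Cod V (Braid V x y) = y \<otimes> x"
    "iso V (Braid V x y)" "Braid V y x \<cdot> Braid V x y = Ident V (x \<otimes> y)"
  using Braid_in_hom[OF assms] iso_Braid[OF assms] Braid_symmetric[OF assms] by (auto simp: hom_def)

lemma Braid_naturality:
  "\<lbrakk>f \<in> Arr V; g \<in> Arr V; Cod V f = x; Cod V g = y\<rbrakk>
    \<Longrightarrow> Braid V x y \<cdot> (f \<otimes>\<^sub>a g) = (g \<otimes>\<^sub>a f) \<cdot> Braid V (Dom V f) (Dom V g)"
  by (rule Braid_natural) (auto simp: hom_def)

text \<open>The hexagon for \<open>x, \<one>, \<one>\<close>, composed with the left unitor of \<open>\<one> \<otimes> x\<close>, becomes this equation tensored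
  with \<open>\<one>\<close> and composed with an invertible symmetry.\<close>

lemma LUnit_Braid:
  assumes x: "x \<in> Obj V"
  shows "LUnit V x \<cdot> Braid V x \<one> = RUnit V x"
proof (rule tensor_unit_faithful)
  show "(LUnit V x \<cdot> Braid V x \<one>) \<otimes>\<^sub>a Ident V \<one> = RUnit V x \<otimes>\<^sub>a Ident V \<one>"
  proof (rule iso_cancel_left[where f = "Braid V x \<one>"])
    have "Braid V x \<one> \<cdot> (RUnit V x \<otimes>\<^sub>a Ident V \<one>) =
        Braid V x \<one> \<cdot> (Ident V x \<otimes>\<^sub>a LUnit V \<one>) \<cdot> Assoc V x \<one> \<one>"
      using x by (simp add: triangle)
    also have "\<dots> = (LUnit V \<one> \<otimes>\<^sub>a Ident V x) \<cdot> Braid V x (\<one> \<otimes> \<one>) \<cdot> Assoc V x \<one> \<one>"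
      using x by (subst comp_extend[OF Braid_naturality]) auto
    also have "\<dots> = LUnit V (\<one> \<otimes> x) \<cdot> Assoc V \<one> \<one> x \<cdot> Braid V x (\<one> \<otimes> \<one>) \<cdot> Assoc V x \<one> \<one>"
      using x by (simp add: comp_extend1[OF LUnit_tensor])
    also have "\<dots> = LUnit V (\<one> \<otimes> x) \<cdot> (Ident V \<one> \<otimes>\<^sub>a Braid V x \<one>) \<cdot> Assoc V \<one> x \<one>
        \<cdot> (Braid V x \<one> \<otimes>\<^sub>a Ident V \<one>)"
      using x by (simp add: hexagon)
    also have "\<dots> = Braid V x \<one> \<cdot> LUnit V (x \<otimes> \<one>) \<cdot> Assoc V \<one> x \<one> \<cdot> (Braid V x \<one> \<otimes>\<^sub>a Ident V \<one>)"
      using x by (subst comp_extend[OF LUnit_naturality]) auto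
    also have "\<dots> = Braid V x \<one> \<cdot> ((LUnit V x \<cdot> Braid V x \<one>) \<otimes>\<^sub>a Ident V \<one>)"
      using x by (simp add: comp_extend1[OF LUnit_tensor])
    finally show "Braid V x \<one> \<cdot> ((LUnit V x \<cdot> Braid V x \<one>) \<otimes>\<^sub>a Ident V \<one>) =
        Braid V x \<one> \<cdot> (RUnit V x \<otimes>\<^sub>a Ident V \<one>)"
      by (rule sym)
  qed (use x in auto)
qed (use x in auto)

lemma RUnit_Braid:
  assumes x: "x \<in> Obj V"
  shows "RUnit V x \<cdot> Braid V \<one> x = LUnit V x"
  using x comp_extend1[OF LUnit_Braid[OF x], of "Braid V \<one> x"] by simp

text \<open>By symmetry, the inverse of the hexagon that moves \<open>c\<close> from the left of \<open>a \<otimes> b\<close> to its right is a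
  hexagon that moves it back.\<close>

lemma second_hexagon:
  assumes o: "a \<in> Obj V" "b \<in> Obj V" "c \<in> Obj V"
  shows "Assoc V c a b \<cdot> (Braid V a c \<otimes>\<^sub>a Ident V b) \<cdot> inverse_of V (Assoc V a c b)
      \<cdot> (Ident V a \<otimes>\<^sub>a Braid V b c) \<cdot> Assoc V a b c = Braid V (a \<otimes> b) c" (is "?X = _")
proof -
  have "?X \<cdot> Braid V c (a \<otimes> b) \<cdot> Assoc V c a b =
    Assoc V c a b \<cdot> (Braid V a c \<otimes>\<^sub>a Ident V b) \<cdot> inverse_of V (Assoc V a c b)
      \<cdot> (Ident V a \<otimes>\<^sub>a Braid V b c) \<cdot> Assoc V a b c \<cdot> Braid V c (a \<otimes> b) \<cdot> Assoc V c a b"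
    using o by simp
  also have "\<dots> = Assoc V c a b"
    using o by (simp add: hexagon)
  finally have eq: "(?X \<cdot> Braid V c (a \<otimes> b)) \<cdot> Assoc V c a b = Ident V (c \<otimes> (a \<otimes> b)) \<cdot> Assoc V c a b"
    using o by simp
  have "?X \<cdot> Braid V c (a \<otimes> b) = Ident V (c \<otimes> (a \<otimes> b))"
    by (rule iso_cancel_right[OF _ _ _ _ _ eq]) (use o in auto)
  also have "\<dots> = Braid V (a \<otimes> b) c \<cdot> Braid V c (a \<otimes> b)"
    using o by simp
  finally have eq': "?X \<cdot> Braid V c (a \<otimes> b) = Braid V (a \<otimes> b) c \<cdot> Braid V c (a \<otimes> b)" .
  show ?thesis
    by (rule iso_cancel_right[OF _ _ _ _ _ eq']) (use o in auto)
qed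

text \<open>Both composites reverse the order of three factors. This is the coherence behind the associativity of
  composition in an opposite enriched category.\<close>

lemma Braid_reverse:
  assumes o: "a \<in> Obj V" "b \<in> Obj V" "c \<in> Obj V"
  shows "Assoc V c b a \<cdot> (Braid V b c \<otimes>\<^sub>a Ident V a) \<cdot> Braid V a (b \<otimes> c) \<cdot> Assoc V a b c =
    (Ident V c \<otimes>\<^sub>a Braid V a b) \<cdot> Braid V (a \<otimes> b) c"
proof -
  have hex: "Assoc V c b a \<cdot> Braid V a (c \<otimes> b) =
      (Ident V c \<otimes>\<^sub>a Braid V a b) \<cdot> Assoc V c a b \<cdot> (Braid V a c \<otimes>\<^sub>a Ident V b)
        \<cdot> inverse_of V (Assoc V a c b)"
    by (rule iso_cancel_right[where f = "Assoc V a c b"]) (use o in \<open>auto simp: hexagon\<close>)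
  have "Assoc V c b a \<cdot> (Braid V b c \<otimes>\<^sub>a Ident V a) \<cdot> Braid V a (b \<otimes> c) \<cdot> Assoc V a b c =
      Assoc V c b a \<cdot> Braid V a (c \<otimes> b) \<cdot> (Ident V a \<otimes>\<^sub>a Braid V b c) \<cdot> Assoc V a b c"
    using o by (subst comp_extend[OF Braid_naturality]) auto
  also have "\<dots> = (Ident V c \<otimes>\<^sub>a Braid V a b) \<cdot> Assoc V c a b \<cdot> (Braid V a c \<otimes>\<^sub>a Ident V b)
        \<cdot> inverse_of V (Assoc V a c b) \<cdot> (Ident V a \<otimes>\<^sub>a Braid V b c) \<cdot> Assoc V a b c"
    using o comp_extend1[OF hex, of "(Ident V a \<otimes>\<^sub>a Braid V b c) \<cdot> Assoc V a b c"] by simp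
  also have "\<dots> = (Ident V c \<otimes>\<^sub>a Braid V a b) \<cdot> Braid V (a \<otimes> b) c"
    using o by (simp add: second_hexagon)
  finally show ?thesis .
qed

end

section \<open>Opposite enriched categories and change of base\<close>

context enriched_category
begin

lemma EHom_obj [simp]: "x \<in> EObj C \<Longrightarrow> y \<in> EObj C \<Longrightarrow> EHom C x y \<in> Obj V"
  by (rule EHom_in_Obj)

lemma EId_arr [simp]:
  assumes "x \<in> EObj C"
  shows "EId C x \<in> Arr V" "Dom V (EId C x) = \<one>" "Cod V (EId C x) = EHom C x x"
  using EId_in_hom[OF assms] by (auto simp: hom_def)

lemma EComp_arr [simp]:
  assumes "x \<in> EObj C" "y \<in> EObj C" "z \<in> EObj C"
  shows "EComp C x y z \<in> Arr V" "Dom V (EComp C x y z) = EHom C y z \<otimes> EHom C x y"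
    "Cod V (EComp C x y z) = EHom C x z"
  using EComp_in_hom[OF assms] by (auto simp: hom_def)

end

lemma enriched_category_opposite:
  assumes "symmetric_monoidal_category V" "enriched_category V C"
  shows "enriched_category V (opposite V C)"
proof -
  interpret symmetric_monoidal_category V by fact
  interpret C: enriched_category V C by fact
  show ?thesis
  proof
    fix w x y z
    assume "w \<in> EObj (opposite V C)" "x \<in> EObj (opposite V C)" "y \<in> EObj (opposite V C)"
      "z \<in> EObj (opposite V C)"
    then have o: "w \<in> EObj C" "x \<in> EObj C" "y \<in> EObj C" "z \<in> EObj C"
      by (auto simp: opposite_def)
    let ?a = "EHom C z y" and ?b = "EHom C y x" and ?c = "EHom C x w"
    have "EComp C z x w \<cdot>\<^bsub>V\<^esub> Braid V (EHom C z x) ?c \<cdot>\<^bsub>V\<^esub>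
        ((EComp C z y x \<cdot>\<^bsub>V\<^esub> Braid V ?a ?b) \<otimes>\<^sub>a\<^bsub>V\<^esub> Ident V ?c) =
      EComp C z x w \<cdot>\<^bsub>V\<^esub> (Ident V ?c \<otimes>\<^sub>a\<^bsub>V\<^esub> EComp C z y x)
        \<cdot>\<^bsub>V\<^esub> (Ident V ?c \<otimes>\<^sub>a\<^bsub>V\<^esub> Braid V ?a ?b) \<cdot>\<^bsub>V\<^esub> Braid V (?a \<otimes>\<^bsub>V\<^esub> ?b) ?c"
      using o by (simp add: Braid_naturality)
    also have "\<dots> = EComp C z x w \<cdot>\<^bsub>V\<^esub> (Ident V ?c \<otimes>\<^sub>a\<^bsub>V\<^esub> EComp C z y x)
        \<cdot>\<^bsub>V\<^esub> Assoc V ?c ?b ?a \<cdot>\<^bsub>V\<^esub> (Braid V ?b ?c \<otimes>\<^sub>a\<^bsub>V\<^esub> Ident V ?a)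
        \<cdot>\<^bsub>V\<^esub> Braid V ?a (?b \<otimes>\<^bsub>V\<^esub> ?c) \<cdot>\<^bsub>V\<^esub> Assoc V ?a ?b ?c"
      using o by (subst Braid_reverse) auto
    also have "\<dots> = (EComp C z x w \<cdot>\<^bsub>V\<^esub> (Ident V ?c \<otimes>\<^sub>a\<^bsub>V\<^esub> EComp C z y x)
        \<cdot>\<^bsub>V\<^esub> Assoc V ?c ?b ?a) \<cdot>\<^bsub>V\<^esub> (Braid V ?b ?c \<otimes>\<^sub>a\<^bsub>V\<^esub> Ident V ?a)
        \<cdot>\<^bsub>V\<^esub> Braid V ?a (?b \<otimes>\<^bsub>V\<^esub> ?c) \<cdot>\<^bsub>V\<^esub> Assoc V ?a ?b ?c"
      using o by simp
    also have "\<dots> = (EComp C z y w \<cdot>\<^bsub>V\<^esub> (EComp C y x w \<otimes>\<^sub>a\<^bsub>V\<^esub> Ident V ?a))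
        \<cdot>\<^bsub>V\<^esub> (Braid V ?b ?c \<otimes>\<^sub>a\<^bsub>V\<^esub> Ident V ?a)
        \<cdot>\<^bsub>V\<^esub> Braid V ?a (?b \<otimes>\<^bsub>V\<^esub> ?c) \<cdot>\<^bsub>V\<^esub> Assoc V ?a ?b ?c"
      using o by (simp only: C.EComp_assoc)
    also have "\<dots> = EComp C z y w \<cdot>\<^bsub>V\<^esub> Braid V ?a (EHom C y w)
        \<cdot>\<^bsub>V\<^esub> (Ident V ?a \<otimes>\<^sub>a\<^bsub>V\<^esub> (EComp C y x w \<cdot>\<^bsub>V\<^esub> Braid V ?b ?c)) \<cdot>\<^bsub>V\<^esub> Assoc V ?a ?b ?c"
      using o by (subst comp_extend[OF Braid_naturality]) auto
    finally show "EComp (opposite V C) w x z \<cdot>\<^bsub>V\<^esub>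
          (EComp (opposite V C) x y z \<otimes>\<^sub>a\<^bsub>V\<^esub> Ident V (EHom (opposite V C) w x)) =
        EComp (opposite V C) w y z \<cdot>\<^bsub>V\<^esub>
          (Ident V (EHom (opposite V C) y z) \<otimes>\<^sub>a\<^bsub>V\<^esub> EComp (opposite V C) w x y) \<cdot>\<^bsub>V\<^esub>
          Assoc V (EHom (opposite V C) y z) (EHom (opposite V C) x y) (EHom (opposite V C) w x)"
      using o by (simp add: opposite_def)
  next
    fix x y
    assume "x \<in> EObj (opposite V C)" "y \<in> EObj (opposite V C)"
    then have o: "x \<in> EObj C" "y \<in> EObj C"
      by (auto simp: opposite_def)
    have "EComp C y y x \<cdot>\<^bsub>V\<^esub> (Ident V (EHom C y x) \<otimes>\<^sub>a\<^bsub>V\<^esub> EId C y) \<cdot>\<^bsub>V\<^esub> Braid V \<one>\<^bsub>V\<^esub> (EHom C y x)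
        = LUnit V (EHom C y x)"
      using o by (subst comp_extend1[OF C.EComp_EId]) (auto simp: RUnit_Braid)
    then show "EComp (opposite V C) x y y \<cdot>\<^bsub>V\<^esub>
        (EId (opposite V C) y \<otimes>\<^sub>a\<^bsub>V\<^esub> Ident V (EHom (opposite V C) x y)) =
        LUnit V (EHom (opposite V C) x y)"
      using o by (simp add: opposite_def Braid_naturality)
    have "EComp C y x x \<cdot>\<^bsub>V\<^esub> (EId C x \<otimes>\<^sub>a\<^bsub>V\<^esub> Ident V (EHom C y x)) \<cdot>\<^bsub>V\<^esub> Braid V (EHom C y x) \<one>\<^bsub>V\<^esub>
        = RUnit V (EHom C y x)"
      using o by (subst comp_extend1[OF C.EId_EComp]) (auto simp: LUnit_Braid)
    then show "EComp (opposite V C) x x y \<cdot>\<^bsub>V\<^esub>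
        (Ident V (EHom (opposite V C) x y) \<otimes>\<^sub>a\<^bsub>V\<^esub> EId (opposite V C) x) =
        RUnit V (EHom (opposite V C) x y)"
      using o by (simp add: opposite_def Braid_naturality)
  qed (auto simp: opposite_def hom_def)
qed

context cat_functor
begin

lemma FObj_obj [simp]: "x \<in> Obj C \<Longrightarrow> FObj F x \<in> Obj D"
  by (rule FObj_in_Obj)

lemma FArr_arr [simp]:
  assumes "f \<in> Arr C"
  shows "FArr F f \<in> Arr D" "Dom D (FArr F f) = FObj F (Dom C f)" "Cod D (FArr F f) = FObj F (Cod C f)"
  using FArr_in_hom[of f "Dom C f" "Cod C f"] assms by (auto simp: hom_def)

lemma FArr_ident [simp]: "x \<in> Obj C \<Longrightarrow> FArr F (Ident C x) = Ident D (FObj F x)"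
  by (rule FArr_Ident)

lemma FArr_comp [simp]:
  assumes "f \<in> Arr C" "g \<in> Arr C" "Dom C g = Cod C f"
  shows "FArr F (g \<cdot>\<^bsub>C\<^esub> f) = FArr F g \<cdot>\<^bsub>D\<^esub> FArr F f"
  using FArr_Comp[of f "Dom C f" "Cod C f" g "Cod C g"] assms by (auto simp: hom_def)

lemma iso_FArr:
  assumes "iso C f"
  shows "iso D (FArr F f)"
proof (rule D.isoI)
  note f = C.iso_arr[OF assms]
  show "FArr F (inverse_of C f) \<cdot>\<^bsub>D\<^esub> FArr F f = Ident D (FObj F (Dom C f))"
    using FArr_comp[of f "inverse_of C f"] assms f C.Dom_in_Obj by simp
  show "FArr F f \<cdot>\<^bsub>D\<^esub> FArr F (inverse_of C f) = Ident D (FObj F (Cod C f))"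
    using FArr_comp[of "inverse_of C f" f] assms f C.Cod_in_Obj by simp
qed (use assms C.iso_arr[OF assms] in \<open>auto simp: D.hom_iff\<close>)

end

context lax_monoidal_functor
begin

lemma LaxUnit_arr [simp]:
  "LaxUnit G \<in> Arr W" "Dom W (LaxUnit G) = \<one>\<^bsub>W\<^esub>" "Cod W (LaxUnit G) = FObj G \<one>\<^bsub>V\<^esub>"
  using LaxUnit_in_hom by (auto simp: hom_def)

lemma LaxMult_arr [simp]:
  assumes "x \<in> Obj V" "y \<in> Obj V"
  shows "LaxMult G x y \<in> Arr W" "Dom W (LaxMult G x y) = FObj G x \<otimes>\<^bsub>W\<^esub> FObj G y"
    "Cod W (LaxMult G x y) = FObj G (x \<otimes>\<^bsub>V\<^esub> y)"
  using LaxMult_in_hom[OF assms] by (auto simp: hom_def)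

lemma LaxMult_naturality:
  "\<lbrakk>f \<in> Arr V; g \<in> Arr V; Cod V f = x'; Cod V g = y'\<rbrakk> \<Longrightarrow>
    LaxMult G x' y' \<cdot>\<^bsub>W\<^esub> (FArr G f \<otimes>\<^sub>a\<^bsub>W\<^esub> FArr G g) =
      FArr G (f \<otimes>\<^sub>a\<^bsub>V\<^esub> g) \<cdot>\<^bsub>W\<^esub> LaxMult G (Dom V f) (Dom V g)"
  by (rule LaxMult_natural) (auto simp: hom_def)

lemma LaxMult_naturality_left:
  "\<lbrakk>f \<in> Arr V; y \<in> Obj V; Cod V f = x'\<rbrakk> \<Longrightarrow>
    LaxMult G x' y \<cdot>\<^bsub>W\<^esub> (FArr G f \<otimes>\<^sub>a\<^bsub>W\<^esub> Ident W (FObj G y)) =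
      FArr G (f \<otimes>\<^sub>a\<^bsub>V\<^esub> Ident V y) \<cdot>\<^bsub>W\<^esub> LaxMult G (Dom V f) y"
  using LaxMult_naturality[of f "Ident V y" x' y] by simp

lemma LaxMult_naturality_right:
  "\<lbrakk>f \<in> Arr V; y \<in> Obj V; Cod V f = x'\<rbrakk> \<Longrightarrow>
    LaxMult G y x' \<cdot>\<^bsub>W\<^esub> (Ident W (FObj G y) \<otimes>\<^sub>a\<^bsub>W\<^esub> FArr G f) =
      FArr G (Ident V y \<otimes>\<^sub>a\<^bsub>V\<^esub> f) \<cdot>\<^bsub>W\<^esub> LaxMult G y (Dom V f)"
  using LaxMult_naturality[of "Ident V y" f y x'] by simp

end

text \<open>Each axiom is the image under \<open>G\<close> of the corresponding axiom of \<open>C\<close>: naturality of the lax structure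
  collects the images of the structure maps of \<open>C\<close> on the left, and the lax coherence axiom then
  rearranges what remains.\<close>

lemma enriched_category_change_of_base:
  assumes "lax_monoidal_functor V W G" "enriched_category V C"
  shows "enriched_category W (change_of_base W G C)"
proof -
  interpret lax_monoidal_functor V W G by fact
  interpret C: enriched_category V C by fact
  show ?thesis
  proof
    fix w x y z
    assume "w \<in> EObj (change_of_base W G C)" "x \<in> EObj (change_of_base W G C)"
      "y \<in> EObj (change_of_base W G C)" "z \<in> EObj (change_of_base W G C)"
    then have o: "w \<in> EObj C" "x \<in> EObj C" "y \<in> EObj C" "z \<in> EObj C"
      by (auto simp: change_of_base_def)
    let ?a = "EHom C y z" and ?b = "EHom C x y" and ?c = "EHom C w x"
    have "FArr G (EComp C w x z) \<cdot>\<^bsub>W\<^esub> LaxMult G (EHom C x z) ?c \<cdot>\<^bsub>W\<^esub>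
        ((FArr G (EComp C x y z) \<cdot>\<^bsub>W\<^esub> LaxMult G ?a ?b) \<otimes>\<^sub>a\<^bsub>W\<^esub> Ident W (FObj G ?c)) =
      FArr G (EComp C w x z) \<cdot>\<^bsub>W\<^esub> LaxMult G (EHom C x z) ?c \<cdot>\<^bsub>W\<^esub>
        (FArr G (EComp C x y z) \<otimes>\<^sub>a\<^bsub>W\<^esub> Ident W (FObj G ?c))
        \<cdot>\<^bsub>W\<^esub> (LaxMult G ?a ?b \<otimes>\<^sub>a\<^bsub>W\<^esub> Ident W (FObj G ?c))"
      using o by simp
    also have "\<dots> = FArr G (EComp C w x z) \<cdot>\<^bsub>W\<^esub> FArr G (EComp C x y z \<otimes>\<^sub>a\<^bsub>V\<^esub> Ident V ?c)
        \<cdot>\<^bsub>W\<^esub> LaxMult G (?a \<otimes>\<^bsub>V\<^esub> ?b) ?c \<cdot>\<^bsub>W\<^esub> (LaxMult G ?a ?b \<otimes>\<^sub>a\<^bsub>W\<^esub> Ident W (FObj G ?c))"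
      using o by (subst W.comp_extend[OF LaxMult_naturality_left]) auto
    also have "\<dots> = FArr G (EComp C w x z \<cdot>\<^bsub>V\<^esub> (EComp C x y z \<otimes>\<^sub>a\<^bsub>V\<^esub> Ident V ?c))
        \<cdot>\<^bsub>W\<^esub> LaxMult G (?a \<otimes>\<^bsub>V\<^esub> ?b) ?c \<cdot>\<^bsub>W\<^esub> (LaxMult G ?a ?b \<otimes>\<^sub>a\<^bsub>W\<^esub> Ident W (FObj G ?c))"
      using o by simp
    also have "\<dots> = FArr G (EComp C w y z) \<cdot>\<^bsub>W\<^esub> FArr G (Ident V ?a \<otimes>\<^sub>a\<^bsub>V\<^esub> EComp C w x y)
        \<cdot>\<^bsub>W\<^esub> FArr G (Assoc V ?a ?b ?c) \<cdot>\<^bsub>W\<^esub> LaxMult G (?a \<otimes>\<^bsub>V\<^esub> ?b) ?c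
        \<cdot>\<^bsub>W\<^esub> (LaxMult G ?a ?b \<otimes>\<^sub>a\<^bsub>W\<^esub> Ident W (FObj G ?c))"
      using o by (simp add: C.EComp_assoc)
    also have "\<dots> = FArr G (EComp C w y z) \<cdot>\<^bsub>W\<^esub> FArr G (Ident V ?a \<otimes>\<^sub>a\<^bsub>V\<^esub> EComp C w x y)
        \<cdot>\<^bsub>W\<^esub> LaxMult G ?a (?b \<otimes>\<^bsub>V\<^esub> ?c) \<cdot>\<^bsub>W\<^esub> (Ident W (FObj G ?a) \<otimes>\<^sub>a\<^bsub>W\<^esub> LaxMult G ?b ?c)
        \<cdot>\<^bsub>W\<^esub> Assoc W (FObj G ?a) (FObj G ?b) (FObj G ?c)"
      using o by (simp add: Lax_assoc)
    also have "\<dots> = FArr G (EComp C w y z) \<cdot>\<^bsub>W\<^esub> LaxMult G ?a (EHom C w y)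
        \<cdot>\<^bsub>W\<^esub> (Ident W (FObj G ?a) \<otimes>\<^sub>a\<^bsub>W\<^esub> FArr G (EComp C w x y))
        \<cdot>\<^bsub>W\<^esub> (Ident W (FObj G ?a) \<otimes>\<^sub>a\<^bsub>W\<^esub> LaxMult G ?b ?c)
        \<cdot>\<^bsub>W\<^esub> Assoc W (FObj G ?a) (FObj G ?b) (FObj G ?c)"
      using o by (subst W.comp_extend[OF LaxMult_naturality_right]) auto
    finally show "EComp (change_of_base W G C) w x z \<cdot>\<^bsub>W\<^esub>
          (EComp (change_of_base W G C) x y z \<otimes>\<^sub>a\<^bsub>W\<^esub> Ident W (EHom (change_of_base W G C) w x)) =
        EComp (change_of_base W G C) w y z \<cdot>\<^bsub>W\<^esub>
          (Ident W (EHom (change_of_base W G C) y z) \<otimes>\<^sub>a\<^bsub>W\<^esub> EComp (change_of_base W G C) w x y) \<cdot>\<^bsub>W\<^esub>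
          Assoc W (EHom (change_of_base W G C) y z) (EHom (change_of_base W G C) x y)
            (EHom (change_of_base W G C) w x)"
      using o by (simp add: change_of_base_def)
  next
    fix x y
    assume "x \<in> EObj (change_of_base W G C)" "y \<in> EObj (change_of_base W G C)"
    then have o: "x \<in> EObj C" "y \<in> EObj C"
      by (auto simp: change_of_base_def)
    let ?a = "EHom C x y"
    have "FArr G (EComp C x y y) \<cdot>\<^bsub>W\<^esub> LaxMult G (EHom C y y) ?a
        \<cdot>\<^bsub>W\<^esub> (FArr G (EId C y) \<otimes>\<^sub>a\<^bsub>W\<^esub> Ident W (FObj G ?a)) \<cdot>\<^bsub>W\<^esub> (LaxUnit G \<otimes>\<^sub>a\<^bsub>W\<^esub> Ident W (FObj G ?a)) =
      FArr G (EComp C x y y) \<cdot>\<^bsub>W\<^esub> FArr G (EId C y \<otimes>\<^sub>a\<^bsub>V\<^esub> Ident V ?a)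
        \<cdot>\<^bsub>W\<^esub> LaxMult G \<one>\<^bsub>V\<^esub> ?a \<cdot>\<^bsub>W\<^esub> (LaxUnit G \<otimes>\<^sub>a\<^bsub>W\<^esub> Ident W (FObj G ?a))"
      using o by (subst W.comp_extend[OF LaxMult_naturality_left]) auto
    also have "\<dots> = FArr G (EComp C x y y \<cdot>\<^bsub>V\<^esub> (EId C y \<otimes>\<^sub>a\<^bsub>V\<^esub> Ident V ?a))
        \<cdot>\<^bsub>W\<^esub> LaxMult G \<one>\<^bsub>V\<^esub> ?a \<cdot>\<^bsub>W\<^esub> (LaxUnit G \<otimes>\<^sub>a\<^bsub>W\<^esub> Ident W (FObj G ?a))"
      using o by simp
    also have "\<dots> = LUnit W (FObj G ?a)"
      using o by (simp add: C.EId_EComp Lax_lunit)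
    finally show "EComp (change_of_base W G C) x y y \<cdot>\<^bsub>W\<^esub>
        (EId (change_of_base W G C) y \<otimes>\<^sub>a\<^bsub>W\<^esub> Ident W (EHom (change_of_base W G C) x y)) =
        LUnit W (EHom (change_of_base W G C) x y)"
      using o by (simp add: change_of_base_def)
    have "FArr G (EComp C x x y) \<cdot>\<^bsub>W\<^esub> LaxMult G ?a (EHom C x x)
        \<cdot>\<^bsub>W\<^esub> (Ident W (FObj G ?a) \<otimes>\<^sub>a\<^bsub>W\<^esub> FArr G (EId C x)) \<cdot>\<^bsub>W\<^esub> (Ident W (FObj G ?a) \<otimes>\<^sub>a\<^bsub>W\<^esub> LaxUnit G) =
      FArr G (EComp C x x y) \<cdot>\<^bsub>W\<^esub> FArr G (Ident V ?a \<otimes>\<^sub>a\<^bsub>V\<^esub> EId C x)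
        \<cdot>\<^bsub>W\<^esub> LaxMult G ?a \<one>\<^bsub>V\<^esub> \<cdot>\<^bsub>W\<^esub> (Ident W (FObj G ?a) \<otimes>\<^sub>a\<^bsub>W\<^esub> LaxUnit G)"
      using o by (subst W.comp_extend[OF LaxMult_naturality_right]) auto
    also have "\<dots> = FArr G (EComp C x x y \<cdot>\<^bsub>V\<^esub> (Ident V ?a \<otimes>\<^sub>a\<^bsub>V\<^esub> EId C x))
        \<cdot>\<^bsub>W\<^esub> LaxMult G ?a \<one>\<^bsub>V\<^esub> \<cdot>\<^bsub>W\<^esub> (Ident W (FObj G ?a) \<otimes>\<^sub>a\<^bsub>W\<^esub> LaxUnit G)"
      using o by simp
    also have "\<dots> = RUnit W (FObj G ?a)"
      using o by (simp add: C.EComp_EId Lax_runit)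
    finally show "EComp (change_of_base W G C) x x y \<cdot>\<^bsub>W\<^esub>
        (Ident W (EHom (change_of_base W G C) x y) \<otimes>\<^sub>a\<^bsub>W\<^esub> EId (change_of_base W G C) x) =
        RUnit W (EHom (change_of_base W G C) x y)"
      using o by (simp add: change_of_base_def)
  qed (auto simp: change_of_base_def hom_def)
qed

section \<open>Currying and the self-enrichment\<close>

definition uncurry_arrow ::
  "('o, 'a, 'm) closed_symmetric_monoidal_category_scheme \<Rightarrow> 'o \<Rightarrow> 'o \<Rightarrow> 'a \<Rightarrow> 'a" where
  "uncurry_arrow V v x g = Eval V v x \<cdot>\<^bsub>V\<^esub> (g \<otimes>\<^sub>a\<^bsub>V\<^esub> Ident V v)"

context closed_symmetric_monoidal_category
begin

lemma IHom_obj [simp]: "v \<in> Obj V \<Longrightarrow> x \<in> Obj V \<Longrightarrow> IHom V v x \<in> Obj V"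
  by (rule IHom_in_Obj)

lemma Eval_arr [simp]:
  assumes "v \<in> Obj V" "x \<in> Obj V"
  shows "Eval V v x \<in> Arr V" "Dom V (Eval V v x) = IHom V v x \<otimes> v" "Cod V (Eval V v x) = x"
  using Eval_in_hom[OF assms] by (auto simp: hom_def)

lemma uncurry_arr [simp]:
  assumes "g \<in> Arr V" "Cod V g = IHom V v x" "v \<in> Obj V" "x \<in> Obj V"
  shows "uncurry_arrow V v x g \<in> Arr V" "Dom V (uncurry_arrow V v x g) = Dom V g \<otimes> v"
    "Cod V (uncurry_arrow V v x g) = x"
  using assms by (auto simp: uncurry_arrow_def)

lemma curry_arrow_characterization:
  assumes "f \<in> Arr V" "Dom V f = u \<otimes> v" "Cod V f = x" "u \<in> Obj V" "v \<in> Obj V"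
  shows "curry_arrow V u v x f \<in> hom V u (IHom V v x) \<and> uncurry_arrow V v x (curry_arrow V u v x f) = f"
  unfolding uncurry_arrow_def curry_arrow_def
  by (rule theI', rule Eval_universal) (use assms Cod_in_Obj in \<open>auto simp: hom_def\<close>)

lemma curry_arr [simp]:
  assumes "f \<in> Arr V" "Dom V f = u \<otimes> v" "Cod V f = x" "u \<in> Obj V" "v \<in> Obj V"
  shows "curry_arrow V u v x f \<in> Arr V" "Dom V (curry_arrow V u v x f) = u"
    "Cod V (curry_arrow V u v x f) = IHom V v x"
    "uncurry_arrow V v x (curry_arrow V u v x f) = f"
  using curry_arrow_characterization[OF assms] by (auto simp: hom_def)

lemma uncurry_inject:
  assumes "uncurry_arrow V v x g = uncurry_arrow V v x h" "g \<in> Arr V" "h \<in> Arr V"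
    "Dom V g = Dom V h" "Cod V g = IHom V v x" "Cod V h = IHom V v x" "v \<in> Obj V" "x \<in> Obj V"
  shows "g = h"
proof -
  have "uncurry_arrow V v x g \<in> hom V (Dom V g \<otimes> v) x"
    using assms by (auto simp: hom_def)
  from Eval_universal[OF _ _ _ this] show ?thesis
    using assms Dom_in_Obj[of g] by (auto simp: hom_def uncurry_arrow_def)
qed

lemma curry_uncurry [simp]:
  assumes "g \<in> Arr V" "Dom V g = u" "Cod V g = IHom V v x" "v \<in> Obj V" "x \<in> Obj V"
  shows "curry_arrow V u v x (uncurry_arrow V v x g) = g"
  by (rule uncurry_inject[where v = v and x = x]) (use assms Dom_in_Obj[of g] in auto)

lemma bij_uncurry:
  assumes "u \<in> Obj V" "v \<in> Obj V" "x \<in> Obj V"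
  shows "bij_betw (uncurry_arrow V v x) (hom V u (IHom V v x)) (hom V (u \<otimes> v) x)"
  by (rule bij_betw_byWitness[where f' = "curry_arrow V u v x"])
    (use assms in \<open>auto simp: hom_def\<close>)

lemma uncurry_comp:
  assumes "f \<in> Arr V" "g \<in> Arr V" "Dom V g = Cod V f" "Cod V g = IHom V v x" "v \<in> Obj V" "x \<in> Obj V"
  shows "uncurry_arrow V v x (g \<cdot> f) = uncurry_arrow V v x g \<cdot> (f \<otimes>\<^sub>a Ident V v)"
  using assms by (simp add: uncurry_arrow_def)

text \<open>Composition in the self-enrichment is the iterated evaluation; this is its form on
  generalized elements.\<close>

lemma uncurry_self_comp:
  assumes f: "f \<in> Arr V" "Cod V f = IHom V y z" and g: "g \<in> Arr V" "Cod V g = IHom V x y"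
    and o: "x \<in> Obj V" "y \<in> Obj V" "z \<in> Obj V"
  shows "uncurry_arrow V x z (EComp (self_enriched V) x y z \<cdot> (f \<otimes>\<^sub>a g)) =
    uncurry_arrow V y z f \<cdot> (Ident V (Dom V f) \<otimes>\<^sub>a uncurry_arrow V x y g) \<cdot> Assoc V (Dom V f) (Dom V g) x"
proof -
  note d = Dom_in_Obj[OF f(1)] Dom_in_Obj[OF g(1)]
  have "uncurry_arrow V x z (EComp (self_enriched V) x y z \<cdot> (f \<otimes>\<^sub>a g)) =
    Eval V y z \<cdot> (Ident V (IHom V y z) \<otimes>\<^sub>a Eval V x y)
      \<cdot> Assoc V (IHom V y z) (IHom V x y) x \<cdot> ((f \<otimes>\<^sub>a g) \<otimes>\<^sub>a Ident V x)"
    using f g o by (subst uncurry_comp) (auto simp: self_enriched_def)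
  also have "\<dots> = Eval V y z \<cdot> (Ident V (IHom V y z) \<otimes>\<^sub>a Eval V x y)
      \<cdot> (f \<otimes>\<^sub>a (g \<otimes>\<^sub>a Ident V x)) \<cdot> Assoc V (Dom V f) (Dom V g) x"
    using f g o d by (simp add: Assoc_naturality)
  also have "\<dots> = uncurry_arrow V y z f \<cdot> (Ident V (Dom V f) \<otimes>\<^sub>a uncurry_arrow V x y g)
      \<cdot> Assoc V (Dom V f) (Dom V g) x"
    using f g o d by (simp add: uncurry_arrow_def)
  finally show ?thesis .
qed

lemma uncurry_self_comp_extended:
  assumes f: "f \<in> Arr V" "Cod V f = IHom V y z" and g: "g \<in> Arr V" "Cod V g = IHom V x y"
    and h: "h \<in> Arr V" "Cod V h = Dom V f \<otimes> Dom V g"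
    and o: "x \<in> Obj V" "y \<in> Obj V" "z \<in> Obj V"
  shows "uncurry_arrow V x z (EComp (self_enriched V) x y z \<cdot> (f \<otimes>\<^sub>a g) \<cdot> h) =
    uncurry_arrow V y z f \<cdot> (Ident V (Dom V f) \<otimes>\<^sub>a uncurry_arrow V x y g)
      \<cdot> Assoc V (Dom V f) (Dom V g) x \<cdot> (h \<otimes>\<^sub>a Ident V x)"
proof -
  note d = Dom_in_Obj[OF f(1)] Dom_in_Obj[OF g(1)]
  have M: "EComp (self_enriched V) x y z \<in> Arr V"
    "Dom V (EComp (self_enriched V) x y z) = IHom V y z \<otimes> IHom V x y"
    "Cod V (EComp (self_enriched V) x y z) = IHom V x z"
    using o by (auto simp: self_enriched_def)
  have "EComp (self_enriched V) x y z \<cdot> (f \<otimes>\<^sub>a g) \<cdot> h = (EComp (self_enriched V) x y z \<cdot> (f \<otimes>\<^sub>a g)) \<cdot> h"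
    using f g h M by simp
  also have "uncurry_arrow V x z \<dots> =
    uncurry_arrow V x z (EComp (self_enriched V) x y z \<cdot> (f \<otimes>\<^sub>a g)) \<cdot> (h \<otimes>\<^sub>a Ident V x)"
    using f g h M o by (intro uncurry_comp) auto
  finally show ?thesis
    using f g h o d by (simp add: uncurry_self_comp)
qed

lemma self_enriched_simps [simp]:
  "EObj (self_enriched V) = Obj V"
  "EHom (self_enriched V) = IHom V"
  by (simp_all add: self_enriched_def)

lemma self_EId_arr [simp]:
  assumes "x \<in> Obj V"
  shows "EId (self_enriched V) x \<in> Arr V" "Dom V (EId (self_enriched V) x) = \<one>"
    "Cod V (EId (self_enriched V) x) = IHom V x x"
    "uncurry_arrow V x x (EId (self_enriched V) x) = LUnit V x"
  using assms by (auto simp: self_enriched_def)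

lemma self_EComp_arr [simp]:
  assumes "x \<in> Obj V" "y \<in> Obj V" "z \<in> Obj V"
  shows "EComp (self_enriched V) x y z \<in> Arr V"
    "Dom V (EComp (self_enriched V) x y z) = IHom V y z \<otimes> IHom V x y"
    "Cod V (EComp (self_enriched V) x y z) = IHom V x z"
  using assms by (auto simp: self_enriched_def)

lemma uncurry_ident: "v \<in> Obj V \<Longrightarrow> x \<in> Obj V \<Longrightarrow> uncurry_arrow V v x (Ident V (IHom V v x)) = Eval V v x"
  by (simp add: uncurry_arrow_def)

lemma uncurry_EComp:
  assumes "x \<in> Obj V" "y \<in> Obj V" "z \<in> Obj V"
  shows "uncurry_arrow V x z (EComp (self_enriched V) x y z) =
    Eval V y z \<cdot> (Ident V (IHom V y z) \<otimes>\<^sub>a Eval V x y) \<cdot> Assoc V (IHom V y z) (IHom V x y) x"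
  using assms by (simp add: self_enriched_def)

lemma enriched_category_self: "enriched_category V (self_enriched V)"
proof
  fix w x y z
  assume "w \<in> EObj (self_enriched V)" "x \<in> EObj (self_enriched V)" "y \<in> EObj (self_enriched V)"
    "z \<in> EObj (self_enriched V)"
  then have o: "w \<in> Obj V" "x \<in> Obj V" "y \<in> Obj V" "z \<in> Obj V"
    by auto
  let ?M = "EComp (self_enriched V)"
  let ?a = "IHom V y z" and ?b = "IHom V x y" and ?c = "IHom V w x"
  have "?M w x z \<cdot> (?M x y z \<otimes>\<^sub>a Ident V ?c) = ?M w y z \<cdot> (Ident V ?a \<otimes>\<^sub>a ?M w x y) \<cdot> Assoc V ?a ?b ?c"
  proof (rule uncurry_inject)
    have "uncurry_arrow V w z (?M w x z \<cdot> (?M x y z \<otimes>\<^sub>a Ident V ?c)) =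
      Eval V y z \<cdot> (Ident V ?a \<otimes>\<^sub>a Eval V x y) \<cdot> Assoc V ?a ?b x
        \<cdot> ((Ident V ?a \<otimes>\<^sub>a Ident V ?b) \<otimes>\<^sub>a Eval V w x) \<cdot> Assoc V (?a \<otimes> ?b) ?c w"
      using o by (subst uncurry_self_comp) (auto simp: uncurry_ident uncurry_EComp)
    also have "\<dots> = Eval V y z \<cdot> (Ident V ?a \<otimes>\<^sub>a Eval V x y)
        \<cdot> (Ident V ?a \<otimes>\<^sub>a (Ident V ?b \<otimes>\<^sub>a Eval V w x)) \<cdot> Assoc V ?a ?b (?c \<otimes> w) \<cdot> Assoc V (?a \<otimes> ?b) ?c w"
      using o by (subst comp_extend[OF Assoc_naturality]) auto
    also have "\<dots> = Eval V y z \<cdot> (Ident V ?a \<otimes>\<^sub>a Eval V x y)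
        \<cdot> (Ident V ?a \<otimes>\<^sub>a (Ident V ?b \<otimes>\<^sub>a Eval V w x)) \<cdot> (Ident V ?a \<otimes>\<^sub>a Assoc V ?b ?c w)
        \<cdot> Assoc V ?a (?b \<otimes> ?c) w \<cdot> (Assoc V ?a ?b ?c \<otimes>\<^sub>a Ident V w)"
      using o by (simp only: pentagon IHom_obj)
    also have "\<dots> = (Eval V y z \<cdot> (Ident V ?a \<otimes>\<^sub>a uncurry_arrow V w y (?M w x y))
        \<cdot> Assoc V ?a (?b \<otimes> ?c) w) \<cdot> (Assoc V ?a ?b ?c \<otimes>\<^sub>a Ident V w)"
      using o by (simp add: uncurry_EComp)
    also have "\<dots> = uncurry_arrow V w z (?M w y z \<cdot> (Ident V ?a \<otimes>\<^sub>a ?M w x y)) \<cdot> (Assoc V ?a ?b ?c \<otimes>\<^sub>a Ident V w)"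
      using o by (subst uncurry_self_comp) (auto simp: uncurry_ident)
    also have "\<dots> = uncurry_arrow V w z (?M w y z \<cdot> (Ident V ?a \<otimes>\<^sub>a ?M w x y) \<cdot> Assoc V ?a ?b ?c)"
      using o by (subst uncurry_comp[symmetric]) auto
    finally show "uncurry_arrow V w z (?M w x z \<cdot> (?M x y z \<otimes>\<^sub>a Ident V ?c)) =
      uncurry_arrow V w z (?M w y z \<cdot> (Ident V ?a \<otimes>\<^sub>a ?M w x y) \<cdot> Assoc V ?a ?b ?c)" .
  qed (use o in auto)
  then show "EComp (self_enriched V) w x z \<cdot>
        (EComp (self_enriched V) x y z \<otimes>\<^sub>a Ident V (EHom (self_enriched V) w x)) =
      EComp (self_enriched V) w y z \<cdot>
        (Ident V (EHom (self_enriched V) y z) \<otimes>\<^sub>a EComp (self_enriched V) w x y) \<cdot>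
        Assoc V (EHom (self_enriched V) y z) (EHom (self_enriched V) x y) (EHom (self_enriched V) w x)"
    by simp
next
  fix x y
  assume "x \<in> EObj (self_enriched V)" "y \<in> EObj (self_enriched V)"
  then have o: "x \<in> Obj V" "y \<in> Obj V"
    by auto
  let ?a = "IHom V x y"
  have "EComp (self_enriched V) x y y \<cdot> (EId (self_enriched V) y \<otimes>\<^sub>a Ident V ?a) = LUnit V ?a"
  proof (rule uncurry_inject)
    have "uncurry_arrow V x y (EComp (self_enriched V) x y y \<cdot> (EId (self_enriched V) y \<otimes>\<^sub>a Ident V ?a)) =
      LUnit V y \<cdot> (Ident V \<one> \<otimes>\<^sub>a Eval V x y) \<cdot> Assoc V \<one> ?a x"
      using o by (subst uncurry_self_comp) (auto simp: uncurry_ident)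
    also have "\<dots> = Eval V x y \<cdot> LUnit V (?a \<otimes> x) \<cdot> Assoc V \<one> ?a x"
      using o by (subst comp_extend[OF LUnit_naturality]) auto
    also have "\<dots> = uncurry_arrow V x y (LUnit V ?a)"
      using o by (simp add: LUnit_tensor uncurry_arrow_def)
    finally show "uncurry_arrow V x y (EComp (self_enriched V) x y y \<cdot> (EId (self_enriched V) y \<otimes>\<^sub>a Ident V ?a)) =
      uncurry_arrow V x y (LUnit V ?a)" .
  qed (use o in auto)
  then show "EComp (self_enriched V) x y y \<cdot>
      (EId (self_enriched V) y \<otimes>\<^sub>a Ident V (EHom (self_enriched V) x y)) = LUnit V (EHom (self_enriched V) x y)"
    by simp
  have "EComp (self_enriched V) x x y \<cdot> (Ident V ?a \<otimes>\<^sub>a EId (self_enriched V) x) = RUnit V ?a"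
  proof (rule uncurry_inject)
    have "uncurry_arrow V x y (EComp (self_enriched V) x x y \<cdot> (Ident V ?a \<otimes>\<^sub>a EId (self_enriched V) x)) =
      Eval V x y \<cdot> (Ident V ?a \<otimes>\<^sub>a LUnit V x) \<cdot> Assoc V ?a \<one> x"
      using o by (subst uncurry_self_comp) (auto simp: uncurry_ident)
    also have "\<dots> = uncurry_arrow V x y (RUnit V ?a)"
      using o by (simp add: triangle uncurry_arrow_def)
    finally show "uncurry_arrow V x y (EComp (self_enriched V) x x y \<cdot> (Ident V ?a \<otimes>\<^sub>a EId (self_enriched V) x)) =
      uncurry_arrow V x y (RUnit V ?a)" .
  qed (use o in auto)
  then show "EComp (self_enriched V) x x y \<cdot>
      (Ident V (EHom (self_enriched V) x y) \<otimes>\<^sub>a EId (self_enriched V) x) = RUnit V (EHom (self_enriched V) x y)"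
    by simp
qed (auto simp: hom_def)

end

section \<open>Tensors and cotensors as universal elements\<close>

text \<open>The element \<open>u\<close> is universal if composition with it identifies \<open>C(t, y)\<close> with \<open>[v, C(x, y)]\<close>. This is
  expressed on generalized elements \<open>a \<rightarrow> C(t, y)\<close>, with elements of the internal hom uncurried.\<close>

definition tensor_element ::
  "('o, 'a, 'm) monoidal_category_scheme \<Rightarrow> ('c, 'o, 'a, 'k) enriched_category_scheme \<Rightarrow>
   'c \<Rightarrow> 'o \<Rightarrow> 'c \<Rightarrow> 'a \<Rightarrow> bool" where
  "tensor_element V C x v t u \<longleftrightarrow>
     u \<in> hom V v (EHom C x t) \<and>
     (\<forall>y\<in>EObj C. \<forall>a\<in>Obj V.
        bij_betw (\<lambda>f. EComp C x t y \<cdot>\<^bsub>V\<^esub> (f \<otimes>\<^sub>a\<^bsub>V\<^esub> u))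
          (hom V a (EHom C t y)) (hom V (a \<otimes>\<^bsub>V\<^esub> v) (EHom C x y)))"

definition cotensor_element ::
  "('o, 'a, 'm) monoidal_category_scheme \<Rightarrow> ('c, 'o, 'a, 'k) enriched_category_scheme \<Rightarrow>
   'c \<Rightarrow> 'o \<Rightarrow> 'c \<Rightarrow> 'a \<Rightarrow> bool" where
  "cotensor_element V C y v t u \<longleftrightarrow>
     u \<in> hom V v (EHom C t y) \<and>
     (\<forall>x\<in>EObj C. \<forall>a\<in>Obj V.
        bij_betw (\<lambda>f. EComp C x t y \<cdot>\<^bsub>V\<^esub> (u \<otimes>\<^sub>a\<^bsub>V\<^esub> f))
          (hom V a (EHom C x t)) (hom V (v \<otimes>\<^bsub>V\<^esub> a) (EHom C x y)))"

context closed_symmetric_monoidal_category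
begin

lemma name_arrow_arr [simp]:
  assumes "f \<in> Arr V" "Dom V f = p" "Cod V f = q"
  shows "name_arrow V f \<in> Arr V" "Dom V (name_arrow V f) = \<one>" "Cod V (name_arrow V f) = IHom V p q"
    "uncurry_arrow V p q (name_arrow V f) = f \<cdot> LUnit V p"
  using assms Dom_in_Obj[of f] by (auto simp: name_arrow_def)

text \<open>Enriched naturality compares two arrows into an internal hom, so it can be tested after uncurrying.
  There the unitors in its definition cancel against the unitors that occur in the names of the
  components: on one side by \<open>LUnit_tensor\<close>, on the other by the triangle identity.\<close>

lemma enriched_natural_into_self_iff:
  assumes C: "\<And>x y. x \<in> EObj C \<Longrightarrow> y \<in> EObj C \<Longrightarrow> EHom C x y \<in> Obj V"
    and S: "\<And>x y. x \<in> EObj C \<Longrightarrow> y \<in> EObj C \<Longrightarrow>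
      EFArr S x y \<in> hom V (EHom C x y) (IHom V (EFObj S x) (EFObj S y))"
    and T: "\<And>x y. x \<in> EObj C \<Longrightarrow> y \<in> EObj C \<Longrightarrow>
      EFArr T x y \<in> hom V (EHom C x y) (IHom V (EFObj T x) (EFObj T y))"
    and \<phi>: "\<And>x. x \<in> EObj C \<Longrightarrow> \<phi> x \<in> hom V (EFObj S x) (EFObj T x)"
  shows "enriched_natural V C (self_enriched V) S T (\<lambda>x. name_arrow V (\<phi> x)) \<longleftrightarrow>
    (\<forall>x\<in>EObj C. \<forall>y\<in>EObj C.
      \<phi> y \<cdot> uncurry_arrow V (EFObj S x) (EFObj S y) (EFArr S x y) =
      uncurry_arrow V (EFObj T x) (EFObj T y) (EFArr T x y) \<cdot> (Ident V (EHom C x y) \<otimes>\<^sub>a \<phi> x))"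
proof -
  have eq: "(EComp (self_enriched V) (EFObj S x) (EFObj S y) (EFObj T y)
        \<cdot> (name_arrow V (\<phi> y) \<otimes>\<^sub>a EFArr S x y) \<cdot> inverse_of V (LUnit V (EHom C x y)) =
      EComp (self_enriched V) (EFObj S x) (EFObj T x) (EFObj T y)
        \<cdot> (EFArr T x y \<otimes>\<^sub>a name_arrow V (\<phi> x)) \<cdot> inverse_of V (RUnit V (EHom C x y))) \<longleftrightarrow>
      \<phi> y \<cdot> uncurry_arrow V (EFObj S x) (EFObj S y) (EFArr S x y) =
      uncurry_arrow V (EFObj T x) (EFObj T y) (EFArr T x y) \<cdot> (Ident V (EHom C x y) \<otimes>\<^sub>a \<phi> x)"
    (is "?L = ?R \<longleftrightarrow> ?l = ?r") if o: "x \<in> EObj C" "y \<in> EObj C" for x y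
  proof -
    let ?h = "EHom C x y"
    note o' = C[OF o] homD[OF S[OF o]] homD[OF T[OF o]] homD[OF \<phi>[OF o(1)]] homD[OF \<phi>[OF o(2)]]
    have "uncurry_arrow V (EFObj S x) (EFObj T y) ?L =
      \<phi> y \<cdot> LUnit V (EFObj S y) \<cdot> (Ident V \<one> \<otimes>\<^sub>a uncurry_arrow V (EFObj S x) (EFObj S y) (EFArr S x y))
        \<cdot> Assoc V \<one> ?h (EFObj S x) \<cdot> (inverse_of V (LUnit V ?h) \<otimes>\<^sub>a Ident V (EFObj S x))"
      using o' by (simp add: uncurry_self_comp_extended)
    also have "\<dots> = ?l \<cdot> LUnit V (?h \<otimes> EFObj S x)
        \<cdot> Assoc V \<one> ?h (EFObj S x) \<cdot> (inverse_of V (LUnit V ?h) \<otimes>\<^sub>a Ident V (EFObj S x))"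
      using o' by (subst comp_extend[OF LUnit_naturality]) auto
    also have "\<dots> = ?l"
      using o' by (simp add: comp_extend1[OF LUnit_tensor])
    finally have l: "uncurry_arrow V (EFObj S x) (EFObj T y) ?L = ?l" .
    have "uncurry_arrow V (EFObj S x) (EFObj T y) ?R =
      uncurry_arrow V (EFObj T x) (EFObj T y) (EFArr T x y)
        \<cdot> (Ident V ?h \<otimes>\<^sub>a (\<phi> x \<cdot> LUnit V (EFObj S x))) \<cdot> Assoc V ?h \<one> (EFObj S x)
        \<cdot> (inverse_of V (RUnit V ?h) \<otimes>\<^sub>a Ident V (EFObj S x))"
      using o' by (simp add: uncurry_self_comp_extended)
    also have "\<dots> = ?r \<cdot> (Ident V ?h \<otimes>\<^sub>a LUnit V (EFObj S x)) \<cdot> Assoc V ?h \<one> (EFObj S x)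
        \<cdot> (inverse_of V (RUnit V ?h) \<otimes>\<^sub>a Ident V (EFObj S x))"
      using o' by simp
    also have "\<dots> = ?r"
      using o' by (simp add: comp_extend1[OF triangle] del: interchange_extended)
    finally have r: "uncurry_arrow V (EFObj S x) (EFObj T y) ?R = ?r" .
    show ?thesis
    proof
      assume "?l = ?r"
      then have "uncurry_arrow V (EFObj S x) (EFObj T y) ?L = uncurry_arrow V (EFObj S x) (EFObj T y) ?R"
        by (simp only: l r)
      then show "?L = ?R"
        by (rule uncurry_inject) (use o' in auto)
    qed (simp only: l[symmetric] r[symmetric])
  qed
  have "\<forall>x\<in>EObj C. name_arrow V (\<phi> x) \<in> hom V \<one> (EHom (self_enriched V) (EFObj S x) (EFObj T x))"
    using \<phi> by (auto simp: hom_iff)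
  then show ?thesis
    unfolding enriched_natural_def by (simp add: eq)
qed

text \<open>The functor \<open>y \<mapsto> [v, C(x, y)]\<close> is the target of the tensor isomorphisms; after uncurrying, their
  naturality speaks only of the composition of \<open>C\<close>.\<close>

lemma natural_isos_tensor_iff:
  assumes "enriched_category V C" and o: "x \<in> EObj C" "t \<in> EObj C" "v \<in> Obj V"
  shows "natural_isos V C (representable V C t)
      (enriched_compose V (representable V (self_enriched V) v) (representable V C x)) \<phi> \<longleftrightarrow>
    (\<forall>y\<in>EObj C. \<phi> y \<in> hom V (EHom C t y) (IHom V v (EHom C x y)) \<and> iso V (\<phi> y)) \<and>
    (\<forall>y\<in>EObj C. \<forall>z\<in>EObj C.
      uncurry_arrow V v (EHom C x z) (\<phi> z) \<cdot> (EComp C t y z \<otimes>\<^sub>a Ident V v) =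
      EComp C x y z \<cdot> (Ident V (EHom C y z) \<otimes>\<^sub>a uncurry_arrow V v (EHom C x y) (\<phi> y))
        \<cdot> Assoc V (EHom C y z) (EHom C t y) v)"
proof -
  interpret C: enriched_category V C by fact
  let ?S = "representable V C t"
  let ?T = "enriched_compose V (representable V (self_enriched V) v) (representable V C x)"
  let ?rep = "\<lambda>y z. curry_arrow V (EHom C y z) (EHom C x y) (EHom C x z) (EComp C x y z)"
  have S: "EFObj ?S = EHom C t" and T: "EFObj ?T = (\<lambda>y. IHom V v (EHom C x y))"
    by (simp_all add: representable_def enriched_compose_def)
  have T_arr: "EFArr ?T y z \<in> hom V (EHom C y z) (IHom V (EFObj ?T y) (EFObj ?T z))"
    "uncurry_arrow V (EFObj ?T y) (EFObj ?T z) (EFArr ?T y z) =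
      EComp (self_enriched V) v (EHom C x y) (EHom C x z) \<cdot> (?rep y z \<otimes>\<^sub>a Ident V (IHom V v (EHom C x y)))"
    if "y \<in> EObj C" "z \<in> EObj C" for y z
    using that o by (auto simp: T representable_def enriched_compose_def hom_iff uncurry_comp)
  have S_arr: "EFArr ?S y z \<in> hom V (EHom C y z) (IHom V (EFObj ?S y) (EFObj ?S z))"
    "uncurry_arrow V (EFObj ?S y) (EFObj ?S z) (EFArr ?S y z) = EComp C t y z"
    if "y \<in> EObj C" "z \<in> EObj C" for y z
    using that o by (auto simp: S representable_def hom_iff)
  have eq: "(\<phi> z \<cdot> EComp C t y z =
      (EComp (self_enriched V) v (EHom C x y) (EHom C x z) \<cdot> (?rep y z \<otimes>\<^sub>a Ident V (IHom V v (EHom C x y))))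
        \<cdot> (Ident V (EHom C y z) \<otimes>\<^sub>a \<phi> y)) \<longleftrightarrow>
      uncurry_arrow V v (EHom C x z) (\<phi> z) \<cdot> (EComp C t y z \<otimes>\<^sub>a Ident V v) =
      EComp C x y z \<cdot> (Ident V (EHom C y z) \<otimes>\<^sub>a uncurry_arrow V v (EHom C x y) (\<phi> y))
        \<cdot> Assoc V (EHom C y z) (EHom C t y) v" (is "?L = ?R \<longleftrightarrow> ?l = ?r")
    if \<phi>: "\<forall>y\<in>EObj C. \<phi> y \<in> hom V (EHom C t y) (IHom V v (EHom C x y)) \<and> iso V (\<phi> y)"
      and yz: "y \<in> EObj C" "z \<in> EObj C" for y z
  proof -
    note p = homD(1-3)[OF \<phi>[rule_format, OF yz(1), THEN conjunct1]]
      homD(1-3)[OF \<phi>[rule_format, OF yz(2), THEN conjunct1]] yz o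
    have l: "uncurry_arrow V v (EHom C x z) ?L = ?l"
      using p by (simp add: uncurry_comp)
    have "?R = EComp (self_enriched V) v (EHom C x y) (EHom C x z) \<cdot> (?rep y z \<otimes>\<^sub>a \<phi> y)"
      using p by simp
    then have r: "uncurry_arrow V v (EHom C x z) ?R = ?r"
      using p by (simp add: uncurry_self_comp)
    show ?thesis
    proof
      assume "?l = ?r"
      then have "uncurry_arrow V v (EHom C x z) ?L = uncurry_arrow V v (EHom C x z) ?R"
        by (simp only: l r)
      then show "?L = ?R"
        by (rule uncurry_inject) (use p in auto)
    qed (simp only: l[symmetric] r[symmetric])
  qed
  show ?thesis
  proof (cases "\<forall>y\<in>EObj C. \<phi> y \<in> hom V (EHom C t y) (IHom V v (EHom C x y)) \<and> iso V (\<phi> y)")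
    case True
    have "enriched_natural V C (self_enriched V) ?S ?T (\<lambda>y. name_arrow V (\<phi> y)) \<longleftrightarrow>
      (\<forall>y\<in>EObj C. \<forall>z\<in>EObj C.
        \<phi> z \<cdot> uncurry_arrow V (EFObj ?S y) (EFObj ?S z) (EFArr ?S y z) =
        uncurry_arrow V (EFObj ?T y) (EFObj ?T z) (EFArr ?T y z) \<cdot> (Ident V (EHom C y z) \<otimes>\<^sub>a \<phi> y))"
      by (rule enriched_natural_into_self_iff) (use True S_arr T_arr in \<open>auto simp: S T\<close>)
    also have "\<dots> \<longleftrightarrow> (\<forall>y\<in>EObj C. \<forall>z\<in>EObj C.
      uncurry_arrow V v (EHom C x z) (\<phi> z) \<cdot> (EComp C t y z \<otimes>\<^sub>a Ident V v) =
      EComp C x y z \<cdot> (Ident V (EHom C y z) \<otimes>\<^sub>a uncurry_arrow V v (EHom C x y) (\<phi> y))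
        \<cdot> Assoc V (EHom C y z) (EHom C t y) v)"
      by (intro ball_cong refl) (simp only: S_arr(2) T_arr(2) eq[OF True])
    finally show ?thesis
      using True by (simp add: natural_isos_def S T)
  qed (auto simp: natural_isos_def S T)
qed

text \<open>The enriched Yoneda lemma. From natural isomorphisms \<open>\<phi>\<close>, the element \<open>u\<close> is the value of \<open>\<phi> t\<close> at the
  identity of \<open>t\<close>; naturality and the right identity law show that \<open>\<phi> y\<close> is composition with \<open>u\<close>.
  Conversely, composition with \<open>u\<close> is natural by associativity, and it is invertible because it is
  bijective on generalized elements.\<close>

lemma is_tensor_iff:
  assumes "enriched_category V C" and x: "x \<in> EObj C" and v: "v \<in> Obj V"
  shows "is_tensor V C x v t \<longleftrightarrow> t \<in> EObj C \<and> (\<exists>u. tensor_element V C x v t u)"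
proof (cases "t \<in> EObj C")
  case t: True
  interpret C: enriched_category V C by fact
  let ?unc = "\<lambda>y. uncurry_arrow V v (EHom C x y)"
  let ?natural = "\<lambda>\<phi>. natural_isos V C (representable V C t)
      (enriched_compose V (representable V (self_enriched V) v) (representable V C x)) \<phi>"
  note natural_iff = natural_isos_tensor_iff[OF assms(1) x t v]
  have "(\<exists>\<phi>. ?natural \<phi>) \<longleftrightarrow> (\<exists>u. tensor_element V C x v t u)"
  proof
    assume "\<exists>\<phi>. ?natural \<phi>"
    then obtain \<phi> where \<phi>: "\<And>y. y \<in> EObj C \<Longrightarrow> \<phi> y \<in> hom V (EHom C t y) (IHom V v (EHom C x y))"
      "\<And>y. y \<in> EObj C \<Longrightarrow> iso V (\<phi> y)"
      and nat: "\<And>y z. y \<in> EObj C \<Longrightarrow> z \<in> EObj C \<Longrightarrow>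
        ?unc z (\<phi> z) \<cdot> (EComp C t y z \<otimes>\<^sub>a Ident V v) =
        EComp C x y z \<cdot> (Ident V (EHom C y z) \<otimes>\<^sub>a ?unc y (\<phi> y)) \<cdot> Assoc V (EHom C y z) (EHom C t y) v"
      unfolding natural_iff by blast
    note \<phi>_arr [simp] = homD(1-3)[OF \<phi>(1)]
    define u where "u = ?unc t (\<phi> t) \<cdot> (EId C t \<otimes>\<^sub>a Ident V v) \<cdot> inverse_of V (LUnit V v)"
    have u: "u \<in> Arr V" "Dom V u = v" "Cod V u = EHom C x t"
      using x t v by (auto simp: u_def)
    have unc: "?unc y (\<phi> y) = EComp C x t y \<cdot> (Ident V (EHom C t y) \<otimes>\<^sub>a u)" if y: "y \<in> EObj C" for y
    proof -
      let ?h = "EHom C t y" and ?e = "EHom C t t"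
      \<comment> \<open>The triangle identity solved for the inverse unitors, which matches the unitor in \<open>u\<close> with that
        of the right identity law.\<close>
      have tri: "Assoc V ?h \<one> v \<cdot> (inverse_of V (RUnit V ?h) \<otimes>\<^sub>a Ident V v) =
          Ident V ?h \<otimes>\<^sub>a inverse_of V (LUnit V v)"
      proof (rule iso_cancel_left[where f = "Ident V ?h \<otimes>\<^sub>a LUnit V v"])
        show "(Ident V ?h \<otimes>\<^sub>a LUnit V v) \<cdot> Assoc V ?h \<one> v \<cdot> (inverse_of V (RUnit V ?h) \<otimes>\<^sub>a Ident V v) =
          (Ident V ?h \<otimes>\<^sub>a LUnit V v) \<cdot> (Ident V ?h \<otimes>\<^sub>a inverse_of V (LUnit V v))"
          using x t v y by (subst comp_extend1[OF triangle]) auto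
      qed (use x t v y in \<open>simp_all add: iso_tensor iso_ident\<close>)
      have "EComp C x t y \<cdot> (Ident V ?h \<otimes>\<^sub>a u) =
        EComp C x t y \<cdot> (Ident V ?h \<otimes>\<^sub>a ?unc t (\<phi> t)) \<cdot> (Ident V ?h \<otimes>\<^sub>a (EId C t \<otimes>\<^sub>a Ident V v))
          \<cdot> (Ident V ?h \<otimes>\<^sub>a inverse_of V (LUnit V v))"
        using x t v y by (simp add: u_def)
      also have "\<dots> = EComp C x t y \<cdot> (Ident V ?h \<otimes>\<^sub>a ?unc t (\<phi> t)) \<cdot> (Ident V ?h \<otimes>\<^sub>a (EId C t \<otimes>\<^sub>a Ident V v))
          \<cdot> Assoc V ?h \<one> v \<cdot> (inverse_of V (RUnit V ?h) \<otimes>\<^sub>a Ident V v)"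
        using x t v y by (simp only: tri)
      also have "\<dots> = EComp C x t y \<cdot> (Ident V ?h \<otimes>\<^sub>a ?unc t (\<phi> t)) \<cdot> Assoc V ?h ?e v
          \<cdot> ((Ident V ?h \<otimes>\<^sub>a EId C t) \<otimes>\<^sub>a Ident V v) \<cdot> (inverse_of V (RUnit V ?h) \<otimes>\<^sub>a Ident V v)"
        using x t v y
        by (subst comp_extend[OF Assoc_naturality]) (auto simp del: interchange interchange_extended)
      also have "\<dots> = (?unc y (\<phi> y) \<cdot> (EComp C t t y \<otimes>\<^sub>a Ident V v))
          \<cdot> ((Ident V ?h \<otimes>\<^sub>a EId C t) \<otimes>\<^sub>a Ident V v) \<cdot> (inverse_of V (RUnit V ?h) \<otimes>\<^sub>a Ident V v)"
        using x t v y by (simp add: nat)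
      also have "\<dots> = ?unc y (\<phi> y) \<cdot> ((EComp C t t y \<cdot> (Ident V ?h \<otimes>\<^sub>a EId C t)) \<otimes>\<^sub>a Ident V v)
          \<cdot> (inverse_of V (RUnit V ?h) \<otimes>\<^sub>a Ident V v)"
        using x t v y by simp
      also have "\<dots> = ?unc y (\<phi> y)"
        unfolding C.EComp_EId[OF t y] using x t v y by simp
      finally show ?thesis
        by (rule sym)
    qed
    have "bij_betw (\<lambda>f. EComp C x t y \<cdot> (f \<otimes>\<^sub>a u)) (hom V a (EHom C t y)) (hom V (a \<otimes> v) (EHom C x y))"
      if y: "y \<in> EObj C" and a: "a \<in> Obj V" for y a
    proof -
      have "bij_betw (?unc y \<circ> (\<lambda>f. \<phi> y \<cdot> f)) (hom V a (EHom C t y)) (hom V (a \<otimes> v) (EHom C x y))"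
        using bij_postcompose_iso[OF \<phi>(2) \<phi>(1)] bij_uncurry[of a v] x y v a
        by (intro bij_betw_trans) auto
      also have "?this \<longleftrightarrow> ?thesis"
        by (rule bij_betw_cong) (use x y v t a u in \<open>auto simp: hom_iff uncurry_comp unc\<close>)
      finally show ?thesis .
    qed
    then show "\<exists>u. tensor_element V C x v t u"
      unfolding tensor_element_def using u by (auto simp: hom_iff)
  next
    assume "\<exists>u. tensor_element V C x v t u"
    then obtain u where u: "u \<in> hom V v (EHom C x t)"
      and bij: "\<And>y a. y \<in> EObj C \<Longrightarrow> a \<in> Obj V \<Longrightarrow>
        bij_betw (\<lambda>f. EComp C x t y \<cdot> (f \<otimes>\<^sub>a u)) (hom V a (EHom C t y)) (hom V (a \<otimes> v) (EHom C x y))"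
      unfolding tensor_element_def by auto
    note u_arr [simp] = homD(1-3)[OF u]
    define \<phi> where "\<phi> y = curry_arrow V (EHom C t y) v (EHom C x y)
      (EComp C x t y \<cdot> (Ident V (EHom C t y) \<otimes>\<^sub>a u))" for y
    have \<phi> [simp]: "\<phi> y \<in> Arr V" "Dom V (\<phi> y) = EHom C t y" "Cod V (\<phi> y) = IHom V v (EHom C x y)"
      "?unc y (\<phi> y) = EComp C x t y \<cdot> (Ident V (EHom C t y) \<otimes>\<^sub>a u)" if "y \<in> EObj C" for y
      using that x t v by (auto simp: \<phi>_def)
    have "iso V (\<phi> y)" if y: "y \<in> EObj C" for y
    proof (rule iso_if_bij_postcompose)
      fix a
      assume a: "a \<in> Obj V"
      have "bij_betw (?unc y \<circ> (\<lambda>f. \<phi> y \<cdot> f)) (hom V a (EHom C t y)) (hom V (a \<otimes> v) (EHom C x y)) \<longleftrightarrow>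
        bij_betw (\<lambda>f. EComp C x t y \<cdot> (f \<otimes>\<^sub>a u)) (hom V a (EHom C t y)) (hom V (a \<otimes> v) (EHom C x y))"
        by (rule bij_betw_cong) (use x y v t a in \<open>auto simp: hom_iff uncurry_comp\<close>)
      then have "bij_betw (?unc y \<circ> (\<lambda>f. \<phi> y \<cdot> f)) (hom V a (EHom C t y)) (hom V (a \<otimes> v) (EHom C x y))"
        using bij y a by simp
      then show "bij_betw (\<lambda>f. \<phi> y \<cdot> f) (hom V a (EHom C t y)) (hom V a (IHom V v (EHom C x y)))"
        using x y v t a by (subst bij_betw_comp_iff2[OF bij_uncurry]) (auto simp: hom_iff)
    qed (use y in \<open>auto simp: hom_iff\<close>)
    moreover have "?unc z (\<phi> z) \<cdot> (EComp C t y z \<otimes>\<^sub>a Ident V v) =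
      EComp C x y z \<cdot> (Ident V (EHom C y z) \<otimes>\<^sub>a ?unc y (\<phi> y)) \<cdot> Assoc V (EHom C y z) (EHom C t y) v"
      if y: "y \<in> EObj C" and z: "z \<in> EObj C" for y z
    proof -
      have "?unc z (\<phi> z) \<cdot> (EComp C t y z \<otimes>\<^sub>a Ident V v) =
        (EComp C x t z \<cdot> (EComp C t y z \<otimes>\<^sub>a Ident V (EHom C x t)))
          \<cdot> ((Ident V (EHom C y z) \<otimes>\<^sub>a Ident V (EHom C t y)) \<otimes>\<^sub>a u)"
        using x t v y z by simp
      also have "\<dots> = EComp C x y z \<cdot> (Ident V (EHom C y z) \<otimes>\<^sub>a EComp C x t y)
          \<cdot> Assoc V (EHom C y z) (EHom C t y) (EHom C x t)
          \<cdot> ((Ident V (EHom C y z) \<otimes>\<^sub>a Ident V (EHom C t y)) \<otimes>\<^sub>a u)"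
        unfolding C.EComp_assoc[OF x t y z] using x t v y z by simp
      also have "\<dots> = EComp C x y z \<cdot> (Ident V (EHom C y z) \<otimes>\<^sub>a ?unc y (\<phi> y))
          \<cdot> Assoc V (EHom C y z) (EHom C t y) v"
        using x t v y z by (subst Assoc_naturality) auto
      finally show ?thesis .
    qed
    ultimately have "?natural \<phi>"
      unfolding natural_iff by (auto simp: hom_iff)
    then show "\<exists>\<phi>. ?natural \<phi>"
      by blast
  qed
  then show ?thesis
    by (simp add: is_tensor_def t)
qed (simp add: is_tensor_def)

text \<open>A cotensor is a tensor in the opposite category. Naturality of the symmetry turns \<open>f \<otimes> u\<close> into
  \<open>u \<otimes> f\<close> followed by a symmetry, and precomposition with a symmetry does not affect bijectivity.\<close>

lemma is_cotensor_iff: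
  assumes C: "enriched_category V C" and y: "y \<in> EObj C" and v: "v \<in> Obj V"
  shows "is_cotensor V C y v t \<longleftrightarrow> t \<in> EObj C \<and> (\<exists>u. cotensor_element V C y v t u)"
proof (cases "t \<in> EObj C")
  case t: True
  interpret C: enriched_category V C by fact
  have op: "enriched_category V (opposite V C)"
    using symmetric_monoidal_category_axioms C by (rule enriched_category_opposite)
  have "tensor_element V (opposite V C) y v t u \<longleftrightarrow> cotensor_element V C y v t u" for u
  proof (cases "u \<in> hom V v (EHom C t y)")
    case u: True
    have "bij_betw (\<lambda>f. EComp C x t y \<cdot> (u \<otimes>\<^sub>a f)) (hom V a (EHom C x t)) (hom V (v \<otimes> a) (EHom C x y)) \<longleftrightarrow>
      bij_betw (\<lambda>f. (EComp C x t y \<cdot> Braid V (EHom C x t) (EHom C t y)) \<cdot> (f \<otimes>\<^sub>a u))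
        (hom V a (EHom C x t)) (hom V (a \<otimes> v) (EHom C x y))"
      if x: "x \<in> EObj C" and a: "a \<in> Obj V" for x a
    proof -
      have B: "Braid V a v \<in> hom V (a \<otimes> v) (v \<otimes> a)"
        using a v by (auto simp: hom_iff)
      have "bij_betw (\<lambda>f. EComp C x t y \<cdot> (u \<otimes>\<^sub>a f)) (hom V a (EHom C x t)) (hom V (v \<otimes> a) (EHom C x y)) \<longleftrightarrow>
        bij_betw ((\<lambda>f. f \<cdot> Braid V a v) \<circ> (\<lambda>f. EComp C x t y \<cdot> (u \<otimes>\<^sub>a f)))
          (hom V a (EHom C x t)) (hom V (a \<otimes> v) (EHom C x y))"
        by (rule bij_betw_comp_iff2[OF bij_precompose_iso[OF _ B]])
          (use a v x y t u in \<open>auto simp: hom_iff\<close>)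
      also have "\<dots> \<longleftrightarrow> bij_betw (\<lambda>f. (EComp C x t y \<cdot> Braid V (EHom C x t) (EHom C t y)) \<cdot> (f \<otimes>\<^sub>a u))
        (hom V a (EHom C x t)) (hom V (a \<otimes> v) (EHom C x y))"
        by (rule bij_betw_cong) (use a v x y t u in \<open>auto simp: hom_iff Braid_naturality\<close>)
      finally show ?thesis .
    qed
    then show ?thesis
      by (simp add: tensor_element_def cotensor_element_def opposite_def u)
  qed (simp add: tensor_element_def cotensor_element_def opposite_def)
  then show ?thesis
    using is_tensor_iff[OF op, of y v t] y v t
    by (simp add: is_tensor_def is_cotensor_def) (simp add: opposite_def)
qed (simp add: is_cotensor_def)

end

section \<open>Transposition and the oplax structure\<close>

locale lax_monoidal_adjunction =
  V: closed_symmetric_monoidal_category V + W: closed_symmetric_monoidal_category W +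
  lax_monoidal_functor V W G + adjunction W V F G \<eta> \<kappa>
  for V :: "('v, 'a, 'm) closed_symmetric_monoidal_category_scheme"
    and W :: "('w, 'b, 'n) closed_symmetric_monoidal_category_scheme"
    and F :: "('w, 'b, 'v, 'a, 'k) functor_data_scheme"
    and G :: "('v, 'a, 'w, 'b, 'l) lax_functor_data_scheme"
    and \<eta> :: "'w \<Rightarrow> 'b"
    and \<kappa> :: "'v \<Rightarrow> 'a"
begin

abbreviation mate_mult :: "'w \<Rightarrow> 'w \<Rightarrow> 'a" ("\<delta>") where
  "\<delta> x y \<equiv> oplax_mult W V F G \<eta> \<kappa> x y"

abbreviation mate_counit :: "'a" ("\<epsilon>") where
  "\<epsilon> \<equiv> oplax_counit V F G \<kappa>"

definition adjunct :: "'w \<Rightarrow> 'a \<Rightarrow> 'b" where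
  "adjunct w f = FArr G f \<cdot>\<^bsub>W\<^esub> \<eta> w"

definition coadjunct :: "'v \<Rightarrow> 'b \<Rightarrow> 'a" where
  "coadjunct v g = \<kappa> v \<cdot>\<^bsub>V\<^esub> FArr F g"

lemma unit_arr [simp]:
  assumes "w \<in> Obj W"
  shows "\<eta> w \<in> Arr W" "Dom W (\<eta> w) = w" "Cod W (\<eta> w) = FObj G (FObj F w)"
  using unit_in_hom[OF assms] by (auto simp: hom_def)

lemma counit_arr [simp]:
  assumes "v \<in> Obj V"
  shows "\<kappa> v \<in> Arr V" "Dom V (\<kappa> v) = FObj F (FObj G v)" "Cod V (\<kappa> v) = v"
  using counit_in_hom[OF assms] by (auto simp: hom_def)

lemma unit_naturality:
  "f \<in> Arr W \<Longrightarrow> Cod W f = w \<Longrightarrow> \<eta> w \<cdot>\<^bsub>W\<^esub> f = FArr G (FArr F f) \<cdot>\<^bsub>W\<^esub> \<eta> (Dom W f)"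
  by (rule unit_natural) (auto simp: hom_def)

lemma counit_naturality:
  "g \<in> Arr V \<Longrightarrow> Cod V g = v \<Longrightarrow> \<kappa> v \<cdot>\<^bsub>V\<^esub> FArr F (FArr G g) = g \<cdot>\<^bsub>V\<^esub> \<kappa> (Dom V g)"
  by (rule counit_natural) (auto simp: hom_def)

lemma adjunct_arr [simp]:
  assumes "f \<in> Arr V" "Dom V f = FObj F w" "w \<in> Obj W"
  shows "adjunct w f \<in> Arr W" "Dom W (adjunct w f) = w" "Cod W (adjunct w f) = FObj G (Cod V f)"
  using assms by (auto simp: adjunct_def)

lemma coadjunct_arr [simp]:
  assumes "g \<in> Arr W" "Cod W g = FObj G v" "v \<in> Obj V"
  shows "coadjunct v g \<in> Arr V" "Dom V (coadjunct v g) = FObj F (Dom W g)"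
    "Cod V (coadjunct v g) = v"
  using assms by (auto simp: coadjunct_def)

lemma adjunct_coadjunct [simp]:
  assumes "g \<in> Arr W" "Dom W g = w" "Cod W g = FObj G v" "v \<in> Obj V" "w \<in> Obj W"
  shows "adjunct w (coadjunct v g) = g"
proof -
  have "adjunct w (coadjunct v g) = FArr G (\<kappa> v) \<cdot>\<^bsub>W\<^esub> FArr G (FArr F g) \<cdot>\<^bsub>W\<^esub> \<eta> w"
    using assms by (simp add: adjunct_def coadjunct_def)
  also have "\<dots> = FArr G (\<kappa> v) \<cdot>\<^bsub>W\<^esub> \<eta> (FObj G v) \<cdot>\<^bsub>W\<^esub> g"
    using assms by (simp add: unit_naturality)
  also have "\<dots> = g"
    using assms W.comp_extend1[OF triangle_right[of v], of g] by simp
  finally show ?thesis .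
qed

lemma coadjunct_adjunct [simp]:
  assumes "f \<in> Arr V" "Dom V f = FObj F w" "Cod V f = v" "w \<in> Obj W"
  shows "coadjunct v (adjunct w f) = f"
proof -
  have v: "v \<in> Obj V"
    using assms V.Cod_in_Obj by auto
  have "coadjunct v (adjunct w f) = \<kappa> v \<cdot>\<^bsub>V\<^esub> FArr F (FArr G f) \<cdot>\<^bsub>V\<^esub> FArr F (\<eta> w)"
    using assms v by (simp add: adjunct_def coadjunct_def)
  also have "\<dots> = f \<cdot>\<^bsub>V\<^esub> \<kappa> (FObj F w) \<cdot>\<^bsub>V\<^esub> FArr F (\<eta> w)"
    using assms v by (subst V.comp_extend[OF counit_naturality]) auto
  also have "\<dots> = f"
    using assms by (simp add: triangle_left)
  finally show ?thesis .
qed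

lemma bij_adjunct:
  assumes "w \<in> Obj W" "v \<in> Obj V"
  shows "bij_betw (adjunct w) (hom V (FObj F w) v) (hom W w (FObj G v))"
  by (rule bij_betw_byWitness[where f' = "coadjunct v"]) (use assms in \<open>auto simp: hom_def\<close>)

lemma bij_coadjunct:
  assumes "w \<in> Obj W" "v \<in> Obj V"
  shows "bij_betw (coadjunct v) (hom W w (FObj G v)) (hom V (FObj F w) v)"
  by (rule bij_betw_byWitness[where f' = "adjunct w"]) (use assms in \<open>auto simp: hom_def\<close>)

lemma adjunct_comp:
  assumes "f \<in> Arr V" "Dom V f = FObj F w" "w \<in> Obj W" "h \<in> Arr V" "Dom V h = Cod V f"
  shows "adjunct w (h \<cdot>\<^bsub>V\<^esub> f) = FArr G h \<cdot>\<^bsub>W\<^esub> adjunct w f"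
  using assms by (simp add: adjunct_def)

lemma adjunct_inject:
  assumes "adjunct w f = adjunct w g" "f \<in> Arr V" "g \<in> Arr V" "Dom V f = FObj F w"
    "Dom V g = FObj F w" "Cod V f = Cod V g" "w \<in> Obj W"
  shows "f = g"
  using assms coadjunct_adjunct by metis

lemma oplax_mult_eq_coadjunct:
  assumes "x \<in> Obj W" "y \<in> Obj W"
  shows "\<delta> x y = coadjunct (FObj F x \<otimes>\<^bsub>V\<^esub> FObj F y)
    (LaxMult G (FObj F x) (FObj F y) \<cdot>\<^bsub>W\<^esub> (\<eta> x \<otimes>\<^sub>a\<^bsub>W\<^esub> \<eta> y))"
  using assms by (simp add: oplax_mult_def coadjunct_def)

lemma oplax_counit_eq_coadjunct: "\<epsilon> = coadjunct \<one>\<^bsub>V\<^esub> (LaxUnit G)"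
  by (simp add: oplax_counit_def coadjunct_def)

lemma oplax_arr [simp]:
  assumes "x \<in> Obj W" "y \<in> Obj W"
  shows "\<delta> x y \<in> Arr V" "Dom V (\<delta> x y) = FObj F (x \<otimes>\<^bsub>W\<^esub> y)"
    "Cod V (\<delta> x y) = FObj F x \<otimes>\<^bsub>V\<^esub> FObj F y"
  using assms by (auto simp: oplax_mult_eq_coadjunct)

lemma oplax_counit_arr [simp]:
  "\<epsilon> \<in> Arr V" "Dom V \<epsilon> = FObj F \<one>\<^bsub>W\<^esub>" "Cod V \<epsilon> = \<one>\<^bsub>V\<^esub>"
  by (auto simp: oplax_counit_eq_coadjunct)

text \<open>The reason why \<open>\<delta>\<close> governs the change of base: it is the adjunct of \<open>\<mu> (\<eta> \<otimes> \<eta>)\<close>, where \<open>\<mu>\<close> is the lax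
  structure map, and \<open>\<mu>\<close> is natural.\<close>

lemma LaxMult_adjunct:
  assumes f: "f \<in> Arr V" "Dom V f = FObj F a" "Cod V f = p"
    and g: "g \<in> Arr V" "Dom V g = FObj F b" "Cod V g = q"
    and o: "a \<in> Obj W" "b \<in> Obj W"
  shows "LaxMult G p q \<cdot>\<^bsub>W\<^esub> (adjunct a f \<otimes>\<^sub>a\<^bsub>W\<^esub> adjunct b g) =
    adjunct (a \<otimes>\<^bsub>W\<^esub> b) ((f \<otimes>\<^sub>a\<^bsub>V\<^esub> g) \<cdot>\<^bsub>V\<^esub> \<delta> a b)"
proof -
  have pq: "p \<in> Obj V" "q \<in> Obj V"
    using f g V.Cod_in_Obj by auto
  have "LaxMult G p q \<cdot>\<^bsub>W\<^esub> (adjunct a f \<otimes>\<^sub>a\<^bsub>W\<^esub> adjunct b g) =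
    LaxMult G p q \<cdot>\<^bsub>W\<^esub> (FArr G f \<otimes>\<^sub>a\<^bsub>W\<^esub> FArr G g) \<cdot>\<^bsub>W\<^esub> (\<eta> a \<otimes>\<^sub>a\<^bsub>W\<^esub> \<eta> b)"
    using f g o pq by (simp add: adjunct_def)
  also have "\<dots> = FArr G (f \<otimes>\<^sub>a\<^bsub>V\<^esub> g) \<cdot>\<^bsub>W\<^esub> LaxMult G (FObj F a) (FObj F b) \<cdot>\<^bsub>W\<^esub> (\<eta> a \<otimes>\<^sub>a\<^bsub>W\<^esub> \<eta> b)"
    using f g o pq by (subst W.comp_extend[OF LaxMult_naturality]) auto
  also have "\<dots> = FArr G (f \<otimes>\<^sub>a\<^bsub>V\<^esub> g) \<cdot>\<^bsub>W\<^esub> adjunct (a \<otimes>\<^bsub>W\<^esub> b) (\<delta> a b)"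
    using o by (simp add: oplax_mult_eq_coadjunct)
  also have "\<dots> = adjunct (a \<otimes>\<^bsub>W\<^esub> b) ((f \<otimes>\<^sub>a\<^bsub>V\<^esub> g) \<cdot>\<^bsub>V\<^esub> \<delta> a b)"
    using f g o by (simp add: adjunct_comp)
  finally show ?thesis .
qed

lemma adjunct_ident: "w \<in> Obj W \<Longrightarrow> adjunct w (Ident V (FObj F w)) = \<eta> w"
  by (simp add: adjunct_def)

lemma adjunct_FArr:
  "f \<in> Arr W \<Longrightarrow> Dom W f = w \<Longrightarrow> w \<in> Obj W \<Longrightarrow> adjunct w (FArr F f) = \<eta> (Cod W f) \<cdot>\<^bsub>W\<^esub> f"
  by (simp add: adjunct_def unit_naturality)

lemma adjunct_oplax_counit: "adjunct \<one>\<^bsub>W\<^esub> \<epsilon> = LaxUnit G"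
  by (simp add: oplax_counit_eq_coadjunct)

text \<open>The unit law of the oplax structure is the mate of the unit law of \<open>G\<close>: both sides have the same
  adjunct.\<close>

lemma oplax_left_unit:
  assumes w: "w \<in> Obj W"
  shows "LUnit V (FObj F w) \<cdot>\<^bsub>V\<^esub> (\<epsilon> \<otimes>\<^sub>a\<^bsub>V\<^esub> Ident V (FObj F w)) \<cdot>\<^bsub>V\<^esub> \<delta> \<one>\<^bsub>W\<^esub> w = FArr F (LUnit W w)"
proof (rule adjunct_inject)
  let ?Fw = "FObj F w"
  have "adjunct (\<one>\<^bsub>W\<^esub> \<otimes>\<^bsub>W\<^esub> w) (LUnit V ?Fw \<cdot>\<^bsub>V\<^esub> (\<epsilon> \<otimes>\<^sub>a\<^bsub>V\<^esub> Ident V ?Fw) \<cdot>\<^bsub>V\<^esub> \<delta> \<one>\<^bsub>W\<^esub> w) =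
    FArr G (LUnit V ?Fw) \<cdot>\<^bsub>W\<^esub> LaxMult G \<one>\<^bsub>V\<^esub> ?Fw \<cdot>\<^bsub>W\<^esub> (LaxUnit G \<otimes>\<^sub>a\<^bsub>W\<^esub> \<eta> w)"
    using w LaxMult_adjunct[of \<epsilon> "\<one>\<^bsub>W\<^esub>" "\<one>\<^bsub>V\<^esub>" "Ident V ?Fw" w ?Fw]
    by (simp add: adjunct_comp adjunct_ident adjunct_oplax_counit)
  also have "\<dots> = (FArr G (LUnit V ?Fw) \<cdot>\<^bsub>W\<^esub> LaxMult G \<one>\<^bsub>V\<^esub> ?Fw
      \<cdot>\<^bsub>W\<^esub> (LaxUnit G \<otimes>\<^sub>a\<^bsub>W\<^esub> Ident W (FObj G ?Fw))) \<cdot>\<^bsub>W\<^esub> (Ident W \<one>\<^bsub>W\<^esub> \<otimes>\<^sub>a\<^bsub>W\<^esub> \<eta> w)"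
    using w by simp
  also have "\<dots> = \<eta> w \<cdot>\<^bsub>W\<^esub> LUnit W w"
    using w by (simp only: Lax_lunit F.FObj_obj) (simp add: W.LUnit_naturality)
  also have "\<dots> = adjunct (\<one>\<^bsub>W\<^esub> \<otimes>\<^bsub>W\<^esub> w) (FArr F (LUnit W w))"
    using w by (simp add: adjunct_FArr)
  finally show "adjunct (\<one>\<^bsub>W\<^esub> \<otimes>\<^bsub>W\<^esub> w) (LUnit V ?Fw \<cdot>\<^bsub>V\<^esub> (\<epsilon> \<otimes>\<^sub>a\<^bsub>V\<^esub> Ident V ?Fw) \<cdot>\<^bsub>V\<^esub> \<delta> \<one>\<^bsub>W\<^esub> w) =
    adjunct (\<one>\<^bsub>W\<^esub> \<otimes>\<^bsub>W\<^esub> w) (FArr F (LUnit W w))" .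
qed (use w in auto)

lemma oplax_right_unit:
  assumes w: "w \<in> Obj W"
  shows "RUnit V (FObj F w) \<cdot>\<^bsub>V\<^esub> (Ident V (FObj F w) \<otimes>\<^sub>a\<^bsub>V\<^esub> \<epsilon>) \<cdot>\<^bsub>V\<^esub> \<delta> w \<one>\<^bsub>W\<^esub> = FArr F (RUnit W w)"
proof (rule adjunct_inject)
  let ?Fw = "FObj F w"
  have "adjunct (w \<otimes>\<^bsub>W\<^esub> \<one>\<^bsub>W\<^esub>) (RUnit V ?Fw \<cdot>\<^bsub>V\<^esub> (Ident V ?Fw \<otimes>\<^sub>a\<^bsub>V\<^esub> \<epsilon>) \<cdot>\<^bsub>V\<^esub> \<delta> w \<one>\<^bsub>W\<^esub>) =
    FArr G (RUnit V ?Fw) \<cdot>\<^bsub>W\<^esub> LaxMult G ?Fw \<one>\<^bsub>V\<^esub> \<cdot>\<^bsub>W\<^esub> (\<eta> w \<otimes>\<^sub>a\<^bsub>W\<^esub> LaxUnit G)"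
    using w LaxMult_adjunct[of "Ident V ?Fw" w ?Fw \<epsilon> "\<one>\<^bsub>W\<^esub>" "\<one>\<^bsub>V\<^esub>"]
    by (simp add: adjunct_comp adjunct_ident adjunct_oplax_counit)
  also have "\<dots> = (FArr G (RUnit V ?Fw) \<cdot>\<^bsub>W\<^esub> LaxMult G ?Fw \<one>\<^bsub>V\<^esub>
      \<cdot>\<^bsub>W\<^esub> (Ident W (FObj G ?Fw) \<otimes>\<^sub>a\<^bsub>W\<^esub> LaxUnit G)) \<cdot>\<^bsub>W\<^esub> (\<eta> w \<otimes>\<^sub>a\<^bsub>W\<^esub> Ident W \<one>\<^bsub>W\<^esub>)"
    using w by simp
  also have "\<dots> = \<eta> w \<cdot>\<^bsub>W\<^esub> RUnit W w"
    using w by (simp only: Lax_runit F.FObj_obj) (simp add: W.RUnit_naturality)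
  also have "\<dots> = adjunct (w \<otimes>\<^bsub>W\<^esub> \<one>\<^bsub>W\<^esub>) (FArr F (RUnit W w))"
    using w by (simp add: adjunct_FArr)
  finally show "adjunct (w \<otimes>\<^bsub>W\<^esub> \<one>\<^bsub>W\<^esub>) (RUnit V ?Fw \<cdot>\<^bsub>V\<^esub> (Ident V ?Fw \<otimes>\<^sub>a\<^bsub>V\<^esub> \<epsilon>) \<cdot>\<^bsub>V\<^esub> \<delta> w \<one>\<^bsub>W\<^esub>) =
    adjunct (w \<otimes>\<^bsub>W\<^esub> \<one>\<^bsub>W\<^esub>) (FArr F (RUnit W w))" .
qed (use w in auto)

lemma iso_oplax_unit_left:
  assumes "iso V \<epsilon>" "w \<in> Obj W"
  shows "iso V (\<delta> \<one>\<^bsub>W\<^esub> w)"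
proof (rule V.iso_of_comp_right)
  show "iso V (LUnit V (FObj F w) \<cdot>\<^bsub>V\<^esub> (\<epsilon> \<otimes>\<^sub>a\<^bsub>V\<^esub> Ident V (FObj F w)))"
    using assms by (intro V.iso_comp V.iso_tensor V.iso_ident) auto
  have "(LUnit V (FObj F w) \<cdot>\<^bsub>V\<^esub> (\<epsilon> \<otimes>\<^sub>a\<^bsub>V\<^esub> Ident V (FObj F w))) \<cdot>\<^bsub>V\<^esub> \<delta> \<one>\<^bsub>W\<^esub> w = FArr F (LUnit W w)"
    using assms oplax_left_unit by simp
  then show "iso V ((LUnit V (FObj F w) \<cdot>\<^bsub>V\<^esub> (\<epsilon> \<otimes>\<^sub>a\<^bsub>V\<^esub> Ident V (FObj F w))) \<cdot>\<^bsub>V\<^esub> \<delta> \<one>\<^bsub>W\<^esub> w)"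
    using assms by (simp only:) (intro F.iso_FArr W.LUnit_arr)
qed (use assms in auto)

lemma iso_oplax_unit_right:
  assumes "iso V \<epsilon>" "w \<in> Obj W"
  shows "iso V (\<delta> w \<one>\<^bsub>W\<^esub>)"
proof (rule V.iso_of_comp_right)
  show "iso V (RUnit V (FObj F w) \<cdot>\<^bsub>V\<^esub> (Ident V (FObj F w) \<otimes>\<^sub>a\<^bsub>V\<^esub> \<epsilon>))"
    using assms by (intro V.iso_comp V.iso_tensor V.iso_ident) auto
  have "(RUnit V (FObj F w) \<cdot>\<^bsub>V\<^esub> (Ident V (FObj F w) \<otimes>\<^sub>a\<^bsub>V\<^esub> \<epsilon>)) \<cdot>\<^bsub>V\<^esub> \<delta> w \<one>\<^bsub>W\<^esub> = FArr F (RUnit W w)"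
    using assms oplax_right_unit by simp
  then show "iso V ((RUnit V (FObj F w) \<cdot>\<^bsub>V\<^esub> (Ident V (FObj F w) \<otimes>\<^sub>a\<^bsub>V\<^esub> \<epsilon>)) \<cdot>\<^bsub>V\<^esub> \<delta> w \<one>\<^bsub>W\<^esub>)"
    using assms by (simp only:) (intro F.iso_FArr W.RUnit_arr)
qed (use assms in auto)

section \<open>Universal elements of the changed base\<close>

lemma change_of_base_simps:
  "EObj (change_of_base W G C) = EObj C"
  "EHom (change_of_base W G C) x y = FObj G (EHom C x y)"
  "EComp (change_of_base W G C) x y z = FArr G (EComp C x y z) \<cdot>\<^bsub>W\<^esub> LaxMult G (EHom C y z) (EHom C x y)"
  by (simp_all add: change_of_base_def)

text \<open>Composition with the element in \<open>G\<^sub>*C\<close> is conjugate, under the bijections of the adjunction, to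
  composition with its adjunct in \<open>C\<close> followed by precomposition with \<open>\<delta>\<close>.\<close>

lemma tensor_element_change_of_base_iff:
  assumes "enriched_category V C" and o: "x \<in> EObj C" "t \<in> EObj C" "w \<in> Obj W"
    and u: "u \<in> hom V (FObj F w) (EHom C x t)"
  shows "tensor_element W (change_of_base W G C) x w t (adjunct w u) \<longleftrightarrow>
    (\<forall>y\<in>EObj C. \<forall>a\<in>Obj W.
      bij_betw (\<lambda>f. EComp C x t y \<cdot>\<^bsub>V\<^esub> (f \<otimes>\<^sub>a\<^bsub>V\<^esub> u) \<cdot>\<^bsub>V\<^esub> \<delta> a w)
        (hom V (FObj F a) (EHom C t y)) (hom V (FObj F (a \<otimes>\<^bsub>W\<^esub> w)) (EHom C x y)))"
proof -
  interpret C: enriched_category V C by fact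
  note u' [simp] = V.homD(1-3)[OF u]
  have "bij_betw (\<lambda>f. EComp (change_of_base W G C) x t y \<cdot>\<^bsub>W\<^esub> (f \<otimes>\<^sub>a\<^bsub>W\<^esub> adjunct w u))
      (hom W a (FObj G (EHom C t y))) (hom W (a \<otimes>\<^bsub>W\<^esub> w) (FObj G (EHom C x y))) \<longleftrightarrow>
    bij_betw (\<lambda>f. EComp C x t y \<cdot>\<^bsub>V\<^esub> (f \<otimes>\<^sub>a\<^bsub>V\<^esub> u) \<cdot>\<^bsub>V\<^esub> \<delta> a w)
      (hom V (FObj F a) (EHom C t y)) (hom V (FObj F (a \<otimes>\<^bsub>W\<^esub> w)) (EHom C x y))"
    (is "bij_betw ?\<Psi> ?A ?B \<longleftrightarrow> bij_betw ?\<Phi> ?A' ?B'")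
    if y: "y \<in> EObj C" and a: "a \<in> Obj W" for y a
  proof -
    have "?\<Psi> f = (adjunct (a \<otimes>\<^bsub>W\<^esub> w) \<circ> (?\<Phi> \<circ> coadjunct (EHom C t y))) f" if "f \<in> ?A" for f
    proof -
      have f: "f \<in> Arr W" "Dom W f = a" "Cod W f = FObj G (EHom C t y)"
        using that by (auto simp: hom_def)
      define g where "g = coadjunct (EHom C t y) f"
      have g: "g \<in> Arr V" "Dom V g = FObj F a" "Cod V g = EHom C t y" "f = adjunct a g"
        using f o a y by (auto simp: g_def)
      have "?\<Psi> f = FArr G (EComp C x t y)
          \<cdot>\<^bsub>W\<^esub> (LaxMult G (EHom C t y) (EHom C x t) \<cdot>\<^bsub>W\<^esub> (adjunct a g \<otimes>\<^sub>a\<^bsub>W\<^esub> adjunct w u))"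
        using g o a y by (simp add: change_of_base_simps)
      also have "\<dots> = adjunct (a \<otimes>\<^bsub>W\<^esub> w) (?\<Phi> g)"
        using g o a y by (simp add: LaxMult_adjunct adjunct_comp)
      finally show ?thesis
        by (simp add: g_def)
    qed
    then have "bij_betw ?\<Psi> ?A ?B \<longleftrightarrow>
      bij_betw (adjunct (a \<otimes>\<^bsub>W\<^esub> w) \<circ> (?\<Phi> \<circ> coadjunct (EHom C t y))) ?A ?B"
      by (rule bij_betw_cong)
    also have "\<dots> \<longleftrightarrow> bij_betw (?\<Phi> \<circ> coadjunct (EHom C t y)) ?A ?B'"
      by (rule bij_betw_comp_iff2[symmetric, OF bij_adjunct])
        (use o a y in \<open>auto simp: hom_def\<close>)
    also have "\<dots> \<longleftrightarrow> bij_betw ?\<Phi> ?A' ?B'"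
      by (rule bij_betw_comp_iff[symmetric, OF bij_coadjunct]) (use o a y in auto)
    finally show ?thesis .
  qed
  moreover have "adjunct w u \<in> hom W w (FObj G (EHom C x t))"
    using o by (auto simp: hom_def)
  ultimately show ?thesis
    by (simp add: tensor_element_def change_of_base_simps(1,2))
qed

lemma cotensor_element_change_of_base_iff:
  assumes "enriched_category V C" and o: "y \<in> EObj C" "t \<in> EObj C" "w \<in> Obj W"
    and u: "u \<in> hom V (FObj F w) (EHom C t y)"
  shows "cotensor_element W (change_of_base W G C) y w t (adjunct w u) \<longleftrightarrow>
    (\<forall>x\<in>EObj C. \<forall>a\<in>Obj W.
      bij_betw (\<lambda>f. EComp C x t y \<cdot>\<^bsub>V\<^esub> (u \<otimes>\<^sub>a\<^bsub>V\<^esub> f) \<cdot>\<^bsub>V\<^esub> \<delta> w a)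
        (hom V (FObj F a) (EHom C x t)) (hom V (FObj F (w \<otimes>\<^bsub>W\<^esub> a)) (EHom C x y)))"
proof -
  interpret C: enriched_category V C by fact
  note u' [simp] = V.homD(1-3)[OF u]
  have "bij_betw (\<lambda>f. EComp (change_of_base W G C) x t y \<cdot>\<^bsub>W\<^esub> (adjunct w u \<otimes>\<^sub>a\<^bsub>W\<^esub> f))
      (hom W a (FObj G (EHom C x t))) (hom W (w \<otimes>\<^bsub>W\<^esub> a) (FObj G (EHom C x y))) \<longleftrightarrow>
    bij_betw (\<lambda>f. EComp C x t y \<cdot>\<^bsub>V\<^esub> (u \<otimes>\<^sub>a\<^bsub>V\<^esub> f) \<cdot>\<^bsub>V\<^esub> \<delta> w a)
      (hom V (FObj F a) (EHom C x t)) (hom V (FObj F (w \<otimes>\<^bsub>W\<^esub> a)) (EHom C x y))"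
    (is "bij_betw ?\<Psi> ?A ?B \<longleftrightarrow> bij_betw ?\<Phi> ?A' ?B'")
    if x: "x \<in> EObj C" and a: "a \<in> Obj W" for x a
  proof -
    have "?\<Psi> f = (adjunct (w \<otimes>\<^bsub>W\<^esub> a) \<circ> (?\<Phi> \<circ> coadjunct (EHom C x t))) f" if "f \<in> ?A" for f
    proof -
      have f: "f \<in> Arr W" "Dom W f = a" "Cod W f = FObj G (EHom C x t)"
        using that by (auto simp: hom_def)
      define g where "g = coadjunct (EHom C x t) f"
      have g: "g \<in> Arr V" "Dom V g = FObj F a" "Cod V g = EHom C x t" "f = adjunct a g"
        using f o a x by (auto simp: g_def)
      have "?\<Psi> f = FArr G (EComp C x t y)
          \<cdot>\<^bsub>W\<^esub> (LaxMult G (EHom C t y) (EHom C x t) \<cdot>\<^bsub>W\<^esub> (adjunct w u \<otimes>\<^sub>a\<^bsub>W\<^esub> adjunct a g))"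
        using g o a x by (simp add: change_of_base_simps)
      also have "\<dots> = adjunct (w \<otimes>\<^bsub>W\<^esub> a) (?\<Phi> g)"
        using g o a x by (simp add: LaxMult_adjunct adjunct_comp)
      finally show ?thesis
        by (simp add: g_def)
    qed
    then have "bij_betw ?\<Psi> ?A ?B \<longleftrightarrow>
      bij_betw (adjunct (w \<otimes>\<^bsub>W\<^esub> a) \<circ> (?\<Phi> \<circ> coadjunct (EHom C x t))) ?A ?B"
      by (rule bij_betw_cong)
    also have "\<dots> \<longleftrightarrow> bij_betw (?\<Phi> \<circ> coadjunct (EHom C x t)) ?A ?B'"
      by (rule bij_betw_comp_iff2[symmetric, OF bij_adjunct])
        (use o a x in \<open>auto simp: hom_def\<close>)
    also have "\<dots> \<longleftrightarrow> bij_betw ?\<Phi> ?A' ?B'"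
      by (rule bij_betw_comp_iff[symmetric, OF bij_coadjunct]) (use o a x in auto)
    finally show ?thesis .
  qed
  moreover have "adjunct w u \<in> hom W w (FObj G (EHom C t y))"
    using o by (auto simp: hom_def)
  ultimately show ?thesis
    by (simp add: cotensor_element_def change_of_base_simps(1,2))
qed

section \<open>Strong monoidal left adjoints transport tensors and cotensors\<close>

lemma enriched_category_base:
  "enriched_category V C \<Longrightarrow> enriched_category W (change_of_base W G C)"
  using lax_monoidal_functor_axioms by (rule enriched_category_change_of_base)

lemma is_tensor_change_of_base:
  assumes strong: "\<And>a b. a \<in> Obj W \<Longrightarrow> b \<in> Obj W \<Longrightarrow> iso V (\<delta> a b)"
    and C: "enriched_category V C" and x: "x \<in> EObj C" and w: "w \<in> Obj W"
    and "is_tensor V C x (FObj F w) t"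
  shows "is_tensor W (change_of_base W G C) x w t"
proof -
  interpret C: enriched_category V C by fact
  obtain u where t: "t \<in> EObj C" and u: "tensor_element V C x (FObj F w) t u"
    using assms by (auto simp: V.is_tensor_iff)
  have u_arr: "u \<in> hom V (FObj F w) (EHom C x t)"
    using u by (simp add: tensor_element_def)
  have "bij_betw (\<lambda>f. EComp C x t y \<cdot>\<^bsub>V\<^esub> (f \<otimes>\<^sub>a\<^bsub>V\<^esub> u) \<cdot>\<^bsub>V\<^esub> \<delta> a w)
      (hom V (FObj F a) (EHom C t y)) (hom V (FObj F (a \<otimes>\<^bsub>W\<^esub> w)) (EHom C x y))"
    if y: "y \<in> EObj C" and a: "a \<in> Obj W" for y a
  proof -
    have "bij_betw (\<lambda>h. h \<cdot>\<^bsub>V\<^esub> \<delta> a w) (hom V (FObj F a \<otimes>\<^bsub>V\<^esub> FObj F w) (EHom C x y))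
        (hom V (FObj F (a \<otimes>\<^bsub>W\<^esub> w)) (EHom C x y))"
      by (rule V.bij_precompose_iso) (use a w strong in \<open>auto simp: hom_def\<close>)
    moreover have "bij_betw (\<lambda>f. EComp C x t y \<cdot>\<^bsub>V\<^esub> (f \<otimes>\<^sub>a\<^bsub>V\<^esub> u))
        (hom V (FObj F a) (EHom C t y)) (hom V (FObj F a \<otimes>\<^bsub>V\<^esub> FObj F w) (EHom C x y))"
      using u y a by (auto simp: tensor_element_def)
    ultimately have "bij_betw ((\<lambda>h. h \<cdot>\<^bsub>V\<^esub> \<delta> a w) \<circ> (\<lambda>f. EComp C x t y \<cdot>\<^bsub>V\<^esub> (f \<otimes>\<^sub>a\<^bsub>V\<^esub> u)))
        (hom V (FObj F a) (EHom C t y)) (hom V (FObj F (a \<otimes>\<^bsub>W\<^esub> w)) (EHom C x y))"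
      by (rule bij_betw_trans[rotated])
    also have "?this \<longleftrightarrow> ?thesis"
      by (rule bij_betw_cong) (use x t y a w u_arr in \<open>auto simp: hom_def\<close>)
    finally show ?thesis .
  qed
  then have "tensor_element W (change_of_base W G C) x w t (adjunct w u)"
    using tensor_element_change_of_base_iff[OF C x t w u_arr] by simp
  then show ?thesis
    using t x w W.is_tensor_iff[OF enriched_category_base[OF C], of x w t]
    by (auto simp: change_of_base_simps(1))
qed

lemma is_cotensor_change_of_base:
  assumes strong: "\<And>a b. a \<in> Obj W \<Longrightarrow> b \<in> Obj W \<Longrightarrow> iso V (\<delta> a b)"
    and C: "enriched_category V C" and y: "y \<in> EObj C" and w: "w \<in> Obj W"
    and "is_cotensor V C y (FObj F w) t"
  shows "is_cotensor W (change_of_base W G C) y w t"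
proof -
  interpret C: enriched_category V C by fact
  obtain u where t: "t \<in> EObj C" and u: "cotensor_element V C y (FObj F w) t u"
    using assms by (auto simp: V.is_cotensor_iff)
  have u_arr: "u \<in> hom V (FObj F w) (EHom C t y)"
    using u by (simp add: cotensor_element_def)
  have "bij_betw (\<lambda>f. EComp C x t y \<cdot>\<^bsub>V\<^esub> (u \<otimes>\<^sub>a\<^bsub>V\<^esub> f) \<cdot>\<^bsub>V\<^esub> \<delta> w a)
      (hom V (FObj F a) (EHom C x t)) (hom V (FObj F (w \<otimes>\<^bsub>W\<^esub> a)) (EHom C x y))"
    if x: "x \<in> EObj C" and a: "a \<in> Obj W" for x a
  proof -
    have "bij_betw (\<lambda>h. h \<cdot>\<^bsub>V\<^esub> \<delta> w a) (hom V (FObj F w \<otimes>\<^bsub>V\<^esub> FObj F a) (EHom C x y))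
        (hom V (FObj F (w \<otimes>\<^bsub>W\<^esub> a)) (EHom C x y))"
      by (rule V.bij_precompose_iso) (use a w strong in \<open>auto simp: hom_def\<close>)
    moreover have "bij_betw (\<lambda>f. EComp C x t y \<cdot>\<^bsub>V\<^esub> (u \<otimes>\<^sub>a\<^bsub>V\<^esub> f))
        (hom V (FObj F a) (EHom C x t)) (hom V (FObj F w \<otimes>\<^bsub>V\<^esub> FObj F a) (EHom C x y))"
      using u x a by (auto simp: cotensor_element_def)
    ultimately have "bij_betw ((\<lambda>h. h \<cdot>\<^bsub>V\<^esub> \<delta> w a) \<circ> (\<lambda>f. EComp C x t y \<cdot>\<^bsub>V\<^esub> (u \<otimes>\<^sub>a\<^bsub>V\<^esub> f)))
        (hom V (FObj F a) (EHom C x t)) (hom V (FObj F (w \<otimes>\<^bsub>W\<^esub> a)) (EHom C x y))"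
      by (rule bij_betw_trans[rotated])
    also have "?this \<longleftrightarrow> ?thesis"
      by (rule bij_betw_cong) (use x t y a w u_arr in \<open>auto simp: hom_def\<close>)
    finally show ?thesis .
  qed
  then have "cotensor_element W (change_of_base W G C) y w t (adjunct w u)"
    using cotensor_element_change_of_base_iff[OF C y t w u_arr] by simp
  then show ?thesis
    using t y w W.is_cotensor_iff[OF enriched_category_base[OF C], of y w t]
    by (auto simp: change_of_base_simps(1))
qed

section \<open>Tensors or cotensors make the left adjoint strong monoidal\<close>

text \<open>Uncurrying turns the universal property of the tensor of \<open>\<one>\<close> by \<open>w\<close> into bijectivity of precomposition
  with an arrow \<open>k b\<close> built from \<open>\<delta> b w\<close> and the uncurried element \<open>v\<close>. The object \<open>b = \<one>\<close>, where \<open>\<delta>\<close> is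
  known to be invertible, yields that \<open>v\<close> is invertible; the object \<open>b = a\<close> then yields the claim.\<close>

lemma oplax_iso_if_tensor:
  assumes \<epsilon>: "iso V \<epsilon>" and w: "w \<in> Obj W" and a: "a \<in> Obj W"
    and tensor: "is_tensor W (change_of_base W G (self_enriched V)) \<one>\<^bsub>V\<^esub> w t"
  shows "iso V (\<delta> a w)"
proof -
  let ?M = "EComp (self_enriched V)"
  note self = V.enriched_category_self
  obtain u' where t: "t \<in> Obj V"
    and u': "tensor_element W (change_of_base W G (self_enriched V)) \<one>\<^bsub>V\<^esub> w t u'"
    using tensor w W.is_tensor_iff[OF enriched_category_base[OF self], of "\<one>\<^bsub>V\<^esub>" w t]
    by (auto simp: change_of_base_simps(1))
  define u where "u = coadjunct (IHom V \<one>\<^bsub>V\<^esub> t) u'"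
  have "u' \<in> hom W w (FObj G (IHom V \<one>\<^bsub>V\<^esub> t))"
    using u' by (simp add: tensor_element_def change_of_base_simps)
  then have u: "u \<in> Arr V" "Dom V u = FObj F w" "Cod V u = IHom V \<one>\<^bsub>V\<^esub> t" "adjunct w u = u'"
    using t w by (auto simp: u_def hom_def)
  have bij: "bij_betw (\<lambda>f. ?M \<one>\<^bsub>V\<^esub> t y \<cdot>\<^bsub>V\<^esub> (f \<otimes>\<^sub>a\<^bsub>V\<^esub> u) \<cdot>\<^bsub>V\<^esub> \<delta> b w)
      (hom V (FObj F b) (IHom V t y)) (hom V (FObj F (b \<otimes>\<^bsub>W\<^esub> w)) (IHom V \<one>\<^bsub>V\<^esub> y))"
    if "y \<in> Obj V" "b \<in> Obj W" for y b
    using that u' t w u tensor_element_change_of_base_iff[OF self, of "\<one>\<^bsub>V\<^esub>" t w u]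
    by (auto simp: hom_def)
  define v where "v = uncurry_arrow V \<one>\<^bsub>V\<^esub> t u"
  have v: "v \<in> Arr V" "Dom V v = FObj F w \<otimes>\<^bsub>V\<^esub> \<one>\<^bsub>V\<^esub>" "Cod V v = t"
    using u t by (auto simp: v_def)
  define k where "k b = (Ident V (FObj F b) \<otimes>\<^sub>a\<^bsub>V\<^esub> v) \<cdot>\<^bsub>V\<^esub> Assoc V (FObj F b) (FObj F w) \<one>\<^bsub>V\<^esub>
    \<cdot>\<^bsub>V\<^esub> (\<delta> b w \<otimes>\<^sub>a\<^bsub>V\<^esub> Ident V \<one>\<^bsub>V\<^esub>)" for b
  have iso_k: "iso V (k b)" if b: "b \<in> Obj W" for b
  proof (rule V.iso_if_bij_precompose)
    show k: "k b \<in> hom V (FObj F (b \<otimes>\<^bsub>W\<^esub> w) \<otimes>\<^bsub>V\<^esub> \<one>\<^bsub>V\<^esub>) (FObj F b \<otimes>\<^bsub>V\<^esub> t)"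
      using b w t v by (auto simp: k_def hom_def)
    fix y
    assume y: "y \<in> Obj V"
    let ?\<Phi> = "\<lambda>f. ?M \<one>\<^bsub>V\<^esub> t y \<cdot>\<^bsub>V\<^esub> (f \<otimes>\<^sub>a\<^bsub>V\<^esub> u) \<cdot>\<^bsub>V\<^esub> \<delta> b w"
    let ?A = "hom V (FObj F b) (IHom V t y)" and ?B = "hom V (FObj F (b \<otimes>\<^bsub>W\<^esub> w) \<otimes>\<^bsub>V\<^esub> \<one>\<^bsub>V\<^esub>) y"
    have "bij_betw (uncurry_arrow V \<one>\<^bsub>V\<^esub> y \<circ> ?\<Phi>) ?A ?B"
      by (rule bij_betw_trans[OF bij V.bij_uncurry]) (use b w y in auto)
    also have "?this \<longleftrightarrow> bij_betw ((\<lambda>g. g \<cdot>\<^bsub>V\<^esub> k b) \<circ> uncurry_arrow V t y) ?A ?B"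
      by (rule bij_betw_cong)
        (use b w y t u v in \<open>auto simp: V.hom_iff V.uncurry_self_comp_extended k_def v_def[symmetric]\<close>)
    also have "\<dots> \<longleftrightarrow> bij_betw (\<lambda>g. g \<cdot>\<^bsub>V\<^esub> k b) (hom V (FObj F b \<otimes>\<^bsub>V\<^esub> t) y) ?B"
      by (rule bij_betw_comp_iff[symmetric, OF V.bij_uncurry]) (use b t y in auto)
    finally show "bij_betw (\<lambda>g. g \<cdot>\<^bsub>V\<^esub> k b) (hom V (FObj F b \<otimes>\<^bsub>V\<^esub> t) y) ?B" .
  qed
  \<comment> \<open>Cancelling \<open>\<delta> \<one> w\<close> from \<open>k \<one>\<close> leaves \<open>F \<one> \<otimes> v\<close>, which \<open>\<epsilon>\<close> identifies with \<open>\<one> \<otimes> v\<close>.\<close>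
  have iso_v: "iso V v"
  proof (rule V.iso_if_unit_tensor_iso)
    let ?F1 = "FObj F \<one>\<^bsub>W\<^esub>"
    have "iso V (Ident V ?F1 \<otimes>\<^sub>a\<^bsub>V\<^esub> v)"
    proof (rule V.iso_of_comp_left)
      show "iso V (Assoc V ?F1 (FObj F w) \<one>\<^bsub>V\<^esub> \<cdot>\<^bsub>V\<^esub> (\<delta> \<one>\<^bsub>W\<^esub> w \<otimes>\<^sub>a\<^bsub>V\<^esub> Ident V \<one>\<^bsub>V\<^esub>))"
        using iso_oplax_unit_left[OF \<epsilon> w] w by (intro V.iso_comp V.iso_tensor V.iso_ident) auto
    qed (use iso_k[of "\<one>\<^bsub>W\<^esub>"] v w in \<open>auto simp: k_def\<close>)
    then have c: "iso V ((Ident V \<one>\<^bsub>V\<^esub> \<otimes>\<^sub>a\<^bsub>V\<^esub> v) \<cdot>\<^bsub>V\<^esub> (\<epsilon> \<otimes>\<^sub>a\<^bsub>V\<^esub> Ident V (FObj F w \<otimes>\<^bsub>V\<^esub> \<one>\<^bsub>V\<^esub>)))"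
      using V.iso_comp[of "Ident V ?F1 \<otimes>\<^sub>a\<^bsub>V\<^esub> v" "\<epsilon> \<otimes>\<^sub>a\<^bsub>V\<^esub> Ident V t"]
        V.iso_tensor[OF \<epsilon> V.iso_ident[OF t]] v w t by simp
    have e: "iso V (\<epsilon> \<otimes>\<^sub>a\<^bsub>V\<^esub> Ident V (FObj F w \<otimes>\<^bsub>V\<^esub> \<one>\<^bsub>V\<^esub>))"
      using \<epsilon> w by (intro V.iso_tensor V.iso_ident) auto
    show "iso V (Ident V \<one>\<^bsub>V\<^esub> \<otimes>\<^sub>a\<^bsub>V\<^esub> v)"
      by (rule V.iso_of_comp_left[OF e c]) (use v w in auto)
  qed (use v in auto)
  have "iso V ((Ident V (FObj F a) \<otimes>\<^sub>a\<^bsub>V\<^esub> v) \<cdot>\<^bsub>V\<^esub> Assoc V (FObj F a) (FObj F w) \<one>\<^bsub>V\<^esub>)"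
    using iso_v v a w by (intro V.iso_comp V.iso_tensor V.iso_ident) auto
  then have "iso V (\<delta> a w \<otimes>\<^sub>a\<^bsub>V\<^esub> Ident V \<one>\<^bsub>V\<^esub>)"
    by (rule V.iso_of_comp_right) (use iso_k[OF a] v a w in \<open>auto simp: k_def\<close>)
  then show ?thesis
    by (rule V.iso_if_tensor_unit_iso) (use a w in auto)
qed

text \<open>Here the universal property does not give an invertible arrow directly. The object \<open>b = \<one>\<close> shows that the
  cotensor \<open>t\<close> of \<open>y\<close> represents \<open>z \<mapsto> Hom(F w \<otimes> z, y)\<close>. Comparing with the object \<open>b = a\<close> shows that
  precomposition with \<open>\<delta> w a \<otimes> \<one>\<close> is bijective on arrows into \<open>y\<close>. Since \<open>y\<close> has to be arbitrary for
  Yoneda, cotensors of all objects are used.\<close>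

lemma oplax_iso_if_cotensors:
  assumes \<epsilon>: "iso V \<epsilon>" and w: "w \<in> Obj W" and a: "a \<in> Obj W"
    and cotensor: "\<And>y. y \<in> Obj V \<Longrightarrow>
      is_cotensor W (change_of_base W G (self_enriched V)) y w (T y)"
  shows "iso V (\<delta> w a)"
proof -
  let ?M = "EComp (self_enriched V)"
  let ?F1 = "FObj F \<one>\<^bsub>W\<^esub>" and ?Fw = "FObj F w" and ?Fa = "FObj F a"
  note self = V.enriched_category_self
  define j where "j = Assoc V ?Fw ?Fa \<one>\<^bsub>V\<^esub> \<cdot>\<^bsub>V\<^esub> (\<delta> w a \<otimes>\<^sub>a\<^bsub>V\<^esub> Ident V \<one>\<^bsub>V\<^esub>)"
  have "iso V j"
  proof (rule V.iso_if_bij_precompose)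
    show "j \<in> hom V (FObj F (w \<otimes>\<^bsub>W\<^esub> a) \<otimes>\<^bsub>V\<^esub> \<one>\<^bsub>V\<^esub>) (?Fw \<otimes>\<^bsub>V\<^esub> (?Fa \<otimes>\<^bsub>V\<^esub> \<one>\<^bsub>V\<^esub>))"
      using a w by (auto simp: j_def hom_def)
    fix y
    assume y: "y \<in> Obj V"
    let ?t = "T y"
    obtain u' where t: "?t \<in> Obj V"
      and u': "cotensor_element W (change_of_base W G (self_enriched V)) y w ?t u'"
      using cotensor[OF y] w y W.is_cotensor_iff[OF enriched_category_base[OF self], of y w ?t]
      by (auto simp: change_of_base_simps(1))
    define u where "u = coadjunct (IHom V ?t y) u'"
    have "u' \<in> hom W w (FObj G (IHom V ?t y))"
      using u' by (simp add: cotensor_element_def change_of_base_simps)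
    then have u: "u \<in> Arr V" "Dom V u = ?Fw" "Cod V u = IHom V ?t y" "adjunct w u = u'"
      using t w y by (auto simp: u_def hom_def)
    have bij: "bij_betw (\<lambda>f. ?M x ?t y \<cdot>\<^bsub>V\<^esub> (u \<otimes>\<^sub>a\<^bsub>V\<^esub> f) \<cdot>\<^bsub>V\<^esub> \<delta> w b)
        (hom V (FObj F b) (IHom V x ?t)) (hom V (FObj F (w \<otimes>\<^bsub>W\<^esub> b)) (IHom V x y))"
      if "x \<in> Obj V" "b \<in> Obj W" for x b
      using that u' t w y u cotensor_element_change_of_base_iff[OF self, of y ?t w u]
      by (auto simp: hom_def)
    define v where "v = uncurry_arrow V ?t y u"
    have v: "v \<in> Arr V" "Dom V v = ?Fw \<otimes>\<^bsub>V\<^esub> ?t" "Cod V v = y"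
      using u t y by (auto simp: v_def)
    have bij_v: "bij_betw
        ((\<lambda>h. h \<cdot>\<^bsub>V\<^esub> Assoc V ?Fw (FObj F b) x \<cdot>\<^bsub>V\<^esub> (\<delta> w b \<otimes>\<^sub>a\<^bsub>V\<^esub> Ident V x)) \<circ>
          (\<lambda>g. v \<cdot>\<^bsub>V\<^esub> (Ident V ?Fw \<otimes>\<^sub>a\<^bsub>V\<^esub> g)))
        (hom V (FObj F b \<otimes>\<^bsub>V\<^esub> x) ?t) (hom V (FObj F (w \<otimes>\<^bsub>W\<^esub> b) \<otimes>\<^bsub>V\<^esub> x) y)"
      (is "bij_betw ?\<Psi> _ ?B")
      if x: "x \<in> Obj V" and b: "b \<in> Obj W" for x b
    proof -
      let ?\<Phi> = "\<lambda>f. ?M x ?t y \<cdot>\<^bsub>V\<^esub> (u \<otimes>\<^sub>a\<^bsub>V\<^esub> f) \<cdot>\<^bsub>V\<^esub> \<delta> w b"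
      let ?A = "hom V (FObj F b) (IHom V x ?t)"
      have "bij_betw (uncurry_arrow V x y \<circ> ?\<Phi>) ?A ?B"
        by (rule bij_betw_trans[OF bij V.bij_uncurry]) (use b w x y in auto)
      also have "?this \<longleftrightarrow> bij_betw (?\<Psi> \<circ> uncurry_arrow V x ?t) ?A ?B"
        by (rule bij_betw_cong)
          (use b w x y t u v in \<open>auto simp: V.hom_iff V.uncurry_self_comp_extended v_def[symmetric]\<close>)
      also have "\<dots> \<longleftrightarrow> bij_betw ?\<Psi> (hom V (FObj F b \<otimes>\<^bsub>V\<^esub> x) ?t) ?B"
        by (rule bij_betw_comp_iff[symmetric, OF V.bij_uncurry]) (use b t x in auto)
      finally show ?thesis .
    qed
    have bij_F1: "bij_betw (\<lambda>g. v \<cdot>\<^bsub>V\<^esub> (Ident V ?Fw \<otimes>\<^sub>a\<^bsub>V\<^esub> g))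
        (hom V (?F1 \<otimes>\<^bsub>V\<^esub> x) ?t) (hom V (?Fw \<otimes>\<^bsub>V\<^esub> (?F1 \<otimes>\<^bsub>V\<^esub> x)) y)" if x: "x \<in> Obj V" for x
    proof -
      let ?i = "Assoc V ?Fw ?F1 x \<cdot>\<^bsub>V\<^esub> (\<delta> w \<one>\<^bsub>W\<^esub> \<otimes>\<^sub>a\<^bsub>V\<^esub> Ident V x)"
      have "iso V ?i"
        using iso_oplax_unit_right[OF \<epsilon> w] w x by (intro V.iso_comp V.iso_tensor V.iso_ident) auto
      then have "bij_betw (\<lambda>h. h \<cdot>\<^bsub>V\<^esub> ?i) (hom V (?Fw \<otimes>\<^bsub>V\<^esub> (?F1 \<otimes>\<^bsub>V\<^esub> x)) y)
          (hom V (FObj F (w \<otimes>\<^bsub>W\<^esub> \<one>\<^bsub>W\<^esub>) \<otimes>\<^bsub>V\<^esub> x) y)"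
        by (rule V.bij_precompose_iso) (use w x in \<open>auto simp: hom_def\<close>)
      then show ?thesis
        by (subst bij_betw_comp_iff2, assumption)
          (use bij_v[OF x W.unit_obj] v w x t in \<open>auto simp: V.hom_iff\<close>)
    qed
    \<comment> \<open>Every object \<open>z\<close> is isomorphic to \<open>F \<one> \<otimes> z\<close>, because \<open>\<epsilon>\<close> is invertible.\<close>
    have bij_all: "bij_betw (\<lambda>g. v \<cdot>\<^bsub>V\<^esub> (Ident V ?Fw \<otimes>\<^sub>a\<^bsub>V\<^esub> g)) (hom V z ?t) (hom V (?Fw \<otimes>\<^bsub>V\<^esub> z) y)"
      if z: "z \<in> Obj V" for z
    proof -
      let ?e = "LUnit V z \<cdot>\<^bsub>V\<^esub> (\<epsilon> \<otimes>\<^sub>a\<^bsub>V\<^esub> Ident V z)"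
      have e: "iso V ?e" "?e \<in> hom V (?F1 \<otimes>\<^bsub>V\<^esub> z) z"
        using \<epsilon> z by (auto simp: hom_def intro!: V.iso_comp V.iso_tensor V.iso_ident)
      have we: "iso V (Ident V ?Fw \<otimes>\<^sub>a\<^bsub>V\<^esub> ?e)"
        "Ident V ?Fw \<otimes>\<^sub>a\<^bsub>V\<^esub> ?e \<in> hom V (?Fw \<otimes>\<^bsub>V\<^esub> (?F1 \<otimes>\<^bsub>V\<^esub> z)) (?Fw \<otimes>\<^bsub>V\<^esub> z)"
        using e w z by (auto simp: hom_def intro!: V.iso_tensor V.iso_ident)
      have "bij_betw ((\<lambda>g. v \<cdot>\<^bsub>V\<^esub> (Ident V ?Fw \<otimes>\<^sub>a\<^bsub>V\<^esub> g)) \<circ> (\<lambda>g. g \<cdot>\<^bsub>V\<^esub> ?e)) (hom V z ?t)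
          (hom V (?Fw \<otimes>\<^bsub>V\<^esub> (?F1 \<otimes>\<^bsub>V\<^esub> z)) y)"
        by (rule bij_betw_trans[OF V.bij_precompose_iso[OF e] bij_F1[OF z]])
      also have "?this \<longleftrightarrow> bij_betw ((\<lambda>h. h \<cdot>\<^bsub>V\<^esub> (Ident V ?Fw \<otimes>\<^sub>a\<^bsub>V\<^esub> ?e)) \<circ>
          (\<lambda>g. v \<cdot>\<^bsub>V\<^esub> (Ident V ?Fw \<otimes>\<^sub>a\<^bsub>V\<^esub> g))) (hom V z ?t) (hom V (?Fw \<otimes>\<^bsub>V\<^esub> (?F1 \<otimes>\<^bsub>V\<^esub> z)) y)"
        by (rule bij_betw_cong) (use v w z t in \<open>auto simp: V.hom_iff\<close>)
      finally show ?thesis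
        by (subst bij_betw_comp_iff2[OF V.bij_precompose_iso[OF we]])
          (use v w z t in \<open>auto simp: V.hom_iff\<close>)
    qed
    have "bij_betw ((\<lambda>h. h \<cdot>\<^bsub>V\<^esub> j) \<circ> (\<lambda>g. v \<cdot>\<^bsub>V\<^esub> (Ident V ?Fw \<otimes>\<^sub>a\<^bsub>V\<^esub> g)))
        (hom V (?Fa \<otimes>\<^bsub>V\<^esub> \<one>\<^bsub>V\<^esub>) ?t) (hom V (FObj F (w \<otimes>\<^bsub>W\<^esub> a) \<otimes>\<^bsub>V\<^esub> \<one>\<^bsub>V\<^esub>) y)"
      using bij_v[OF V.unit_obj a] by (simp add: j_def)
    then show "bij_betw (\<lambda>h. h \<cdot>\<^bsub>V\<^esub> j) (hom V (?Fw \<otimes>\<^bsub>V\<^esub> (?Fa \<otimes>\<^bsub>V\<^esub> \<one>\<^bsub>V\<^esub>)) y)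
        (hom V (FObj F (w \<otimes>\<^bsub>W\<^esub> a) \<otimes>\<^bsub>V\<^esub> \<one>\<^bsub>V\<^esub>) y)"
      by (subst bij_betw_comp_iff[OF bij_all]) (use a in auto)
  qed
  then have "iso V (\<delta> w a \<otimes>\<^sub>a\<^bsub>V\<^esub> Ident V \<one>\<^bsub>V\<^esub>)"
    unfolding j_def by (rule V.iso_of_comp_right[rotated]) (use a w in auto)
  then show ?thesis
    by (rule V.iso_if_tensor_unit_iso) (use a w in auto)
qed

end

theorem proposition3p10:
  fixes V :: "('v, 'a) closed_symmetric_monoidal_category"
    and W :: "('w, 'b) closed_symmetric_monoidal_category"
    and F :: "('w, 'b, 'v, 'a) functor_data"
    and G :: "('v, 'a, 'w, 'b) lax_functor_data"
    and \<eta> :: "'w \<Rightarrow> 'b"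
    and \<kappa> :: "'v \<Rightarrow> 'a"
  assumes "closed_symmetric_monoidal_category V"
    and "closed_symmetric_monoidal_category W"
    and "adjunction W V F G \<eta> \<kappa>"
    and "lax_monoidal_functor V W G"
  shows
    "(left_adjoint_strong_monoidal W V F G \<eta> \<kappa> \<longrightarrow>
       (\<forall>C :: ('c, 'v, 'a) enriched_category. enriched_category V C \<longrightarrow>
          enriched_category W (change_of_base W G C) \<and>
          (\<forall>T. tensoring V C T \<longrightarrow>
             tensoring W (change_of_base W G C) (\<lambda>x w. T x (FObj F w))) \<and>
          (\<forall>T. cotensoring V C T \<longrightarrow>
             cotensoring W (change_of_base W G C) (\<lambda>x w. T x (FObj F w))))) \<and>
     (iso V (oplax_counit V F G \<kappa>) \<and>
        ((\<exists>T. tensoring W (change_of_base W G (self_enriched V)) T) \<or>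
         (\<exists>T. cotensoring W (change_of_base W G (self_enriched V)) T)) \<longrightarrow>
       left_adjoint_strong_monoidal W V F G \<eta> \<kappa>)"
proof -
  interpret lax_monoidal_adjunction V W F G \<eta> \<kappa>
    using assms by (simp add: lax_monoidal_adjunction_def)
  show ?thesis
  proof (intro conjI impI allI)
    fix C :: "('c, 'v, 'a) enriched_category"
    assume strong: "left_adjoint_strong_monoidal W V F G \<eta> \<kappa>" and C: "enriched_category V C"
    show "enriched_category W (change_of_base W G C)"
      using C by (rule enriched_category_base)
    show "tensoring W (change_of_base W G C) (\<lambda>x w. T x (FObj F w))" if "tensoring V C T" for T
      using that strong is_tensor_change_of_base[OF _ C]
      by (simp add: tensoring_def left_adjoint_strong_monoidal_def change_of_base_simps(1))
    show "cotensoring W (change_of_base W G C) (\<lambda>x w. T x (FObj F w))" if "cotensoring V C T" for T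
      using that strong is_cotensor_change_of_base[OF _ C]
      by (simp add: cotensoring_def left_adjoint_strong_monoidal_def change_of_base_simps(1))
  next
    assume "iso V \<epsilon> \<and> ((\<exists>T. tensoring W (change_of_base W G (self_enriched V)) T) \<or>
      (\<exists>T. cotensoring W (change_of_base W G (self_enriched V)) T))"
    then have \<epsilon>: "iso V \<epsilon>" and "(\<exists>T. tensoring W (change_of_base W G (self_enriched V)) T) \<or>
      (\<exists>T. cotensoring W (change_of_base W G (self_enriched V)) T)"
      by auto
    then have "iso V (\<delta> a b)" if "a \<in> Obj W" "b \<in> Obj W" for a b
    proof (elim disjE exE)
      fix T
      assume "tensoring W (change_of_base W G (self_enriched V)) T"
      then show ?thesis
        using oplax_iso_if_tensor[OF \<epsilon> that(2,1), of "T \<one>\<^bsub>V\<^esub> b"] that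
        by (auto simp: tensoring_def change_of_base_simps(1))
    next
      fix T
      assume "cotensoring W (change_of_base W G (self_enriched V)) T"
      then show ?thesis
        using oplax_iso_if_cotensors[OF \<epsilon> that, of "\<lambda>y. T y a"] that
        by (auto simp: cotensoring_def change_of_base_simps(1))
    qed
    with \<epsilon> show "left_adjoint_strong_monoidal W V F G \<eta> \<kappa>"
      by (simp add: left_adjoint_strong_monoidal_def)
  qed
qed

end
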